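(* Let $\phi: \mathbb{P}_2 \to \mathbb{P}_2$ be a continuous Jordan triple endomorphism, i.e., a continuous map satisfying $\phi(ABA)=\phi(A)\phi(B)\phi(A)$ for all $A,B\in\mathbb{P}_2$. Then $\phi$ is of one of the following forms: \begin{itemize} \item[(b1)] there is a unitary matrix $U\in \mathbb{M}_2$ and a real number $c$ such that $\phi(A)=(\det A)^c\, UAU^*$ for all $A\in \mathbb{P}_2$; \item[(b2)] there is a unitary matrix $V\in \mathbb{M}_2$ and a real number $d$ such that $\phi(A)=(\det A)^d\, VA^{-1}V^*$ for all $A\in \mathbb{P}_2$; \item[(b3)] there is a unitary matrix $W\in \mathbb{M}_2$ and real numbers $c_1,c_2$ such that $\phi(A)=W\,\mathrm{Diag}[(\det A)^{c_1}, (\det A)^{c_2}]\,W^*$ for all $A\in \mathbb{P}_2$. \end{itemize}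
   Context: $\mathbb{M}_2$ denotes the algebra of all $2\times 2$ complex matrices and $\mathbb{P}_2\subset\mathbb{M}_2$ denotes the set (cone) of all positive definite (in particular self-adjoint) matrices in $\mathbb{M}_2$. Continuity is with respect to the topology of the operator norm (equivalently, of any norm on $\mathbb{M}_2$). $\mathrm{Diag}[a,b]$ denotes the $2\times 2$ diagonal matrix with diagonal entries $a,b$, and $U^*$ is the conjugate transpose of $U$. *)

theory Defs
  imports "HOL-Analysis.Analysis"
begin

definition conj_transpose :: "complex ^ 'n ^ 'm \<Rightarrow> complex ^ 'm ^ 'n" where
  "conj_transpose A = (\<chi> i j. cnj (A $ j $ i))"

definition unitary :: "complex ^ 'n ^ 'n \<Rightarrow> bool" where
  "unitary U \<longleftrightarrow> conj_transpose U ** U = mat 1 \<and> U ** conj_transpose U = mat 1"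

(* For self-adjoint A the form x* A x is real, so Re discards nothing. *)
definition positive_definite :: "complex ^ 'n ^ 'n \<Rightarrow> bool" where
  "positive_definite A \<longleftrightarrow>
     conj_transpose A = A \<and>
     (\<forall>x. x \<noteq> 0 \<longrightarrow> Re (\<Sum>i\<in>UNIV. cnj (x $ i) * (A *v x) $ i) > 0)"

definition P2 :: "(complex ^ 2 ^ 2) set" where
  "P2 = {A. positive_definite A}"

(* The determinant is a positive real, so below its real powers are taken as Re (det A) powr c. *)
lemma det_P2:
  assumes "A \<in> P2"
  shows "det A = of_real (Re (det A))" and "Re (det A) > 0"
proof -
  have h: "cnj (A $ j $ i) = A $ i $ j" for i j
  proof -
    have "conj_transpose A = A"
      using assms by (simp add: P2_def positive_definite_def)
    then have "conj_transpose A $ i $ j = A $ i $ j" by simp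
    then show ?thesis by (simp add: conj_transpose_def)
  qed
  have q: "Re (\<Sum>i\<in>UNIV. cnj (x $ i) * (A *v x) $ i) > 0" if "x \<noteq> 0" for x
    using assms that by (simp add: P2_def positive_definite_def)
  define a where "a = Re (A $ 1 $ 1)"
  define d where "d = Re (A $ 2 $ 2)"
  define b where "b = A $ 1 $ 2"
  have A11: "A $ 1 $ 1 = of_real a" and A22: "A $ 2 $ 2 = of_real d"
    using h[of 1 1] h[of 2 2] by (auto simp: a_def d_def complex_eq_iff)
  have A12: "A $ 1 $ 2 = b" and A21: "A $ 2 $ 1 = cnj b"
    using h[of 1 2] by (auto simp: b_def)
  have det: "det A = of_real (a * d - (cmod b)\<^sup>2)"
    by (simp add: det_2 A11 A22 A12 A21 complex_norm_square[symmetric])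
  have "vector [1, 0] \<noteq> (0 :: complex ^ 2)"
    by (simp add: vec_eq_iff forall_2)
  from q[OF this] have a: "a > 0"
    by (simp add: sum_2 matrix_vector_mult_def A11 A22 A12 A21)
  have "vector [b, - of_real a] \<noteq> (0 :: complex ^ 2)"
    using a by (simp add: vec_eq_iff forall_2)
  from q[OF this] have "a * (a * d - ((Re b)\<^sup>2 + (Im b)\<^sup>2)) > 0"
    by (simp add: sum_2 matrix_vector_mult_def A11 A22 A12 A21
        algebra_simps power2_eq_square)
  with a have "a * d - (cmod b)\<^sup>2 > 0"
    by (simp add: zero_less_mult_iff cmod_power2)
  then show "det A = of_real (Re (det A))" and "Re (det A) > 0"
    by (simp_all add: det)
qed

definition Diag2 :: "complex \<Rightarrow> complex \<Rightarrow> complex ^ 2 ^ 2" where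
  "Diag2 a b = vector [vector [a, 0], vector [0, b]]"

definition jordan_triple_endomorphism ::
  "(complex ^ 'n ^ 'n) set \<Rightarrow> (complex ^ 'n ^ 'n \<Rightarrow> complex ^ 'n ^ 'n) \<Rightarrow> bool" where
  "jordan_triple_endomorphism S \<phi> \<longleftrightarrow>
     \<phi> \<in> S \<rightarrow> S \<and>
     (\<forall>A\<in>S. \<forall>B\<in>S. \<phi> (A ** B ** A) = \<phi> A ** \<phi> B ** \<phi> A)"

end

theory Submission
  imports Defs
begin

text \<open>
  Write a Hermitian \<open>2 \<times> 2\<close> matrix as a point \<open>(t, v)\<close> of Minkowski space, its coordinates with
  respect to the identity and the Pauli matrices. The determinant becomes the Lorentz form
  \<open>t\<^sup>2 - \<bar>v\<bar>\<^sup>2\<close>, the positive definite matrices become the open future cone, those of determinant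
  one become the hyperboloid (a model of hyperbolic space), and \<open>ABA\<close> becomes the polynomial
  expression \<open>triple\<close>. The proof takes place in these coordinates; matrices return only at the end.

  The core is a rigidity statement (\<open>rigidity\<close>): a continuous triple homomorphism \<open>\<psi>\<close> of the
  hyperboloid is either constant or preserves all inner products. The reason is geometric. The
  midpoint \<open>X\<close> of a hyperbolic segment from \<open>A\<close> to \<open>B\<close> is the only positive solution of
  \<open>X A\<^sup>-\<^sup>1 X = B\<close>, so \<open>\<psi>\<close> maps midpoints to midpoints. Take two distinct points at the same distance
  from the identity and move both out to infinity by repeated squaring: their midpoints stay in a
  bounded set. If the images were at different distances from the identity, the midpoints of the
  images would escape to infinity, which continuity forbids. Hence the distance from the identity to
  \<open>\<psi> A\<close> depends on that of \<open>A\<close> alone, and in terms of hyperbolic cosines this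
  dependence is a function \<open>G\<close>. The hyperbolic Pythagorean theorem for isosceles triangles gives
  \<open>G (u v) = G u G v\<close>, the doubling formula gives \<open>G (2 u\<^sup>2 - 1) = 2 (G u)\<^sup>2 - 1\<close>, and the only
  such functions \<open>G \<ge> 1\<close> are \<open>1\<close> and the identity.

  Applied to a map into a geodesic, rigidity shows that a positive functional that respects the
  triple product is a power of the determinant (\<open>triple_functional_eq_powr\<close>). For a triple
  homomorphism \<open>\<Phi>\<close> of the cone this covers \<open>det \<circ> \<Phi>\<close>, so \<open>\<Phi>\<close> maps the hyperboloid into itself
  and rigidity applies to it. Moreover \<open>\<Phi>\<close> maps commuting matrices to commuting ones, which
  controls the images of the scalar matrices. If \<open>\<Phi>\<close> is constant on the hyperboloid, then
  \<open>\<Phi> A\<close> depends only on \<open>det A\<close> and the values are simultaneously diagonal (\<open>degenerate_form\<close>).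
  Otherwise \<open>\<Phi>\<close> is a power of the determinant times an orthogonal transformation of the vector part
  (\<open>isometric_form\<close>). Every orthogonal transformation of \<open>\<real>\<^sup>3\<close> is, up to sign, conjugation by a unitary
  matrix (\<open>orthogonal_unitarily_implemented\<close>). The sign \<open>-1\<close> turns \<open>(t, v)\<close> into \<open>(t, -v)\<close>, that is,
  \<open>A\<close> into \<open>det A \<cdot> A\<^sup>-\<^sup>1\<close>; the two signs are the two nondegenerate forms.
\<close>

section \<open>The triple product in Minkowski coordinates\<close>

definition bar :: "real \<times> 'a::real_inner \<Rightarrow> real \<times> 'a" where
  "bar a = (fst a, - snd a)"

definition lorentz :: "real \<times> 'a::real_inner \<Rightarrow> real" where
  "lorentz a = a \<bullet> bar a"

text \<open>By Cayley-Hamilton, \<open>ABA = tr (AB) A - det A (tr B - B)\<close>. The trace is twice the first coordinate,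
  so \<open>tr (AB)\<close> is twice the Euclidean inner product, and the adjugate \<open>tr B - B\<close> is \<^term>\<open>bar b\<close>.\<close>
definition triple :: "real \<times> 'a::real_inner \<Rightarrow> real \<times> 'a \<Rightarrow> real \<times> 'a" where
  "triple a b = (2 * (a \<bullet> b)) *\<^sub>R a - lorentz a *\<^sub>R bar b"

definition one :: "real \<times> 'a::real_inner" where
  "one = (1, 0)"

definition future_cone :: "(real \<times> 'a::real_inner) set" where
  "future_cone = {a. 0 < fst a \<and> 0 < lorentz a}"

definition hyperboloid :: "(real \<times> 'a::real_inner) set" where
  "hyperboloid = {a. 0 < fst a \<and> lorentz a = 1}"

lemma fst_bar [simp]: "fst (bar a) = fst a" and snd_bar [simp]: "snd (bar a) = - snd a"
  and bar_bar [simp]: "bar (bar a) = a" and fst_one [simp]: "fst one = 1"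
  and snd_one [simp]: "snd one = 0" and bar_one [simp]: "bar one = one"
  by (simp_all add: bar_def one_def)

lemma bar_linear [simp]: "bar (a + b) = bar a + bar b" "bar (a - b) = bar a - bar b"
  "bar (r *\<^sub>R a) = r *\<^sub>R bar a"
  by (simp_all add: bar_def prod_eq_iff)

lemma inner_bar: "a \<bullet> bar b = bar a \<bullet> b"
  by (simp add: inner_prod_def)

lemma lor_eq: "lorentz a = (fst a)\<^sup>2 - snd a \<bullet> snd a"
  by (simp add: lorentz_def inner_prod_def power2_eq_square)

lemma lor_bar [simp]: "lorentz (bar a) = lorentz a" and lor_one [simp]: "lorentz one = 1"
  and lor_scaleR [simp]: "lorentz (r *\<^sub>R a) = r\<^sup>2 * lorentz a"
  by (simp_all add: lor_eq algebra_simps power2_eq_square)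

lemma lor_add: "lorentz (a + b) = lorentz a + lorentz b + 2 * (a \<bullet> bar b)"
  and lor_diff: "lorentz (a - b) = lorentz a + lorentz b - 2 * (a \<bullet> bar b)"
  by (simp_all add: lor_eq inner_prod_def inner_add_left inner_add_right inner_diff_left
      inner_diff_right inner_commute power2_eq_square algebra_simps)

lemma lor_triple: "lorentz (triple a b) = (lorentz a)\<^sup>2 * lorentz b"
proof -
  have "lorentz (triple a b) = (2 * (a \<bullet> b))\<^sup>2 * lorentz a + (lorentz a)\<^sup>2 * lorentz b
      - 2 * ((2 * (a \<bullet> b)) * lorentz a * (a \<bullet> b))"
    unfolding triple_def lor_diff by simp
  then show ?thesis by (simp add: power2_eq_square)
qed

lemma triple_one_right: "triple a one = (2 * fst a) *\<^sub>R a - lorentz a *\<^sub>R one"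
  by (simp add: triple_def prod_eq_iff inner_prod_def)

lemma triple_scale_one: "triple (s *\<^sub>R one) b = s\<^sup>2 *\<^sub>R b"
  by (simp add: triple_def prod_eq_iff inner_prod_def power2_eq_square)

lemma triple_scaleR_right: "triple a (r *\<^sub>R b) = r *\<^sub>R triple a b"
  by (simp add: triple_def algebra_simps)

lemma fconeD: assumes "a \<in> future_cone" shows "0 < fst a" "0 < lorentz a" "norm (snd a) < fst a"
proof -
  show 1: "0 < fst a" "0 < lorentz a" using assms by (auto simp: future_cone_def)
  then have "(norm (snd a))\<^sup>2 < (fst a)\<^sup>2" by (simp add: lor_eq power2_norm_eq_inner)
  then show "norm (snd a) < fst a" using 1 power_less_imp_less_base by fastforce
qed

lemma hyp_fcone: "a \<in> hyperboloid \<Longrightarrow> a \<in> future_cone" by (simp add: hyperboloid_def future_cone_def)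

lemma hypD: assumes "a \<in> hyperboloid" shows "1 \<le> fst a" "lorentz a = 1" "snd a \<bullet> snd a = (fst a)\<^sup>2 - 1"
proof -
  show 1: "lorentz a = 1" "snd a \<bullet> snd a = (fst a)\<^sup>2 - 1"
    using assms by (auto simp: hyperboloid_def lor_eq)
  have "1 \<le> (fst a)\<^sup>2" using 1(2) inner_ge_zero[of "snd a"] by linarith
  then show "1 \<le> fst a"
    using assms power2_le_imp_le[of 1 "fst a"] by (simp add: hyperboloid_def)
qed

lemma bar_mem [simp]: "bar a \<in> future_cone \<longleftrightarrow> a \<in> future_cone" "bar a \<in> hyperboloid \<longleftrightarrow> a \<in> hyperboloid"
  by (simp_all add: future_cone_def hyperboloid_def)

lemma one_hyp [simp]: "one \<in> hyperboloid" by (simp add: hyperboloid_def)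

lemma one_fcone [simp]: "one \<in> future_cone" by (simp add: hyp_fcone)

lemma abs_inner_snd_less:
  assumes "a \<in> future_cone" "b \<in> future_cone" shows "\<bar>snd a \<bullet> snd b\<bar> < fst a * fst b"
proof -
  have "\<bar>snd a \<bullet> snd b\<bar> \<le> norm (snd a) * norm (snd b)" by (rule Cauchy_Schwarz_ineq2)
  also have "\<dots> < fst a * fst b" using fconeD[OF assms(1)] fconeD[OF assms(2)]
    by (intro mult_strict_mono') auto
  finally show ?thesis .
qed

text \<open>Only the sign of the first coordinate needs an argument: it is at least
  \<open>(t - \<bar>v\<bar>)\<^sup>2\<close> times the first coordinate of \<open>b\<close>, where \<open>a = (t, v)\<close>.\<close>
lemma triple_fcone:
  assumes a: "a \<in> future_cone" and b: "b \<in> future_cone" shows "triple a b \<in> future_cone"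
proof -
  note A = fconeD[OF a] and B = fconeD[OF b]
  have "- (snd a \<bullet> snd b) \<le> norm (snd a) * norm (snd b)"
    using Cauchy_Schwarz_ineq2[of "snd a" "snd b"] by linarith
  also have "\<dots> \<le> norm (snd a) * fst b"
    using B by (intro mult_left_mono) auto
  finally have "- (norm (snd a) * fst b) \<le> snd a \<bullet> snd b" by linarith
  then have 1: "2 * fst a * (- (norm (snd a) * fst b)) \<le> 2 * fst a * (snd a \<bullet> snd b)"
    using A by (intro mult_left_mono) auto
  have "0 < (fst a - norm (snd a))\<^sup>2 * fst b" using A B by simp
  also have "\<dots> = ((fst a)\<^sup>2 + snd a \<bullet> snd a) * fst b + 2 * fst a * (- (norm (snd a) * fst b))"
    by (simp add: power2_diff power2_norm_eq_inner algebra_simps)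
  also have "\<dots> \<le> ((fst a)\<^sup>2 + snd a \<bullet> snd a) * fst b + 2 * fst a * (snd a \<bullet> snd b)"
    using 1 by simp
  also have "\<dots> = fst (triple a b)"
    by (simp add: triple_def lor_eq inner_prod_def algebra_simps power2_eq_square)
  finally show ?thesis using A B by (simp add: future_cone_def lor_triple)
qed

lemma triple_hyp: "a \<in> hyperboloid \<Longrightarrow> b \<in> hyperboloid \<Longrightarrow> triple a b \<in> hyperboloid"
  using triple_fcone[of a b] by (simp add: hyperboloid_def future_cone_def lor_triple)

text \<open>This is \<open>tr (A\<^sup>2 B) = tr (ABA)\<close>; it makes inner products visible to triple homomorphisms.\<close>
lemma inner_triple_one: "triple a one \<bullet> b = fst (triple a b)"
  by (simp add: triple_def lor_eq inner_prod_def algebra_simps power2_eq_square)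

lemma hyp_scaleR_eq: assumes "x \<in> hyperboloid" "y \<in> hyperboloid" "r *\<^sub>R x = y" shows "x = y"
proof -
  have "r\<^sup>2 = 1" using assms lor_scaleR[of r x] by (auto simp: hyperboloid_def)
  moreover have "r * fst x = fst y" using assms(3) by auto
  then have "0 < r" using assms by (auto simp: hyperboloid_def) (metis zero_less_mult_pos2)
  ultimately have "r = 1" by (simp add: power2_eq_1_iff)
  then show ?thesis using assms by simp
qed

lemma triple_bar: assumes "a \<in> hyperboloid" shows "triple a (bar a) = a"
  using hypD[OF assms] by (simp add: triple_def lorentz_def scaleR_2)
    

lemma triple_eq_self_imp_bar:
  assumes "a \<in> hyperboloid" "b \<in> hyperboloid" "triple a b = a" shows "b = bar a"
proof -
  have "(2 * (a \<bullet> b) - 1) *\<^sub>R a = bar b"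
    using assms(3) hypD[OF assms(1)] by (simp add: triple_def algebra_simps)
  then have "a = bar b" using assms hyp_scaleR_eq[of a "bar b"] by simp
  then show ?thesis by simp
qed

text \<open>The midpoint of the hyperbolic segment between two points of the hyperboloid: by symmetry it lies
  on the ray through \<open>a + b\<close>, and the factor makes its Lorentz norm one. For matrices it is
  the geometric mean.\<close>
definition midpt :: "real \<times> 'a::real_inner \<Rightarrow> real \<times> 'a \<Rightarrow> real \<times> 'a" where
  "midpt a b = (1 / sqrt (2 + 2 * (a \<bullet> bar b))) *\<^sub>R (a + b)"

lemma inner_bar_pos: "a \<in> future_cone \<Longrightarrow> b \<in> future_cone \<Longrightarrow> 0 < a \<bullet> bar b"
  using abs_inner_snd_less[of a b] by (simp add: inner_prod_def)

lemma midpt_hyp: assumes "a \<in> hyperboloid" "b \<in> hyperboloid" shows "midpt a b \<in> hyperboloid"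
proof -
  have p: "0 < a \<bullet> bar b" using inner_bar_pos hyp_fcone assms by blast
  then show ?thesis using assms hypD[OF assms(1)] hypD[OF assms(2)]
    by (simp add: hyperboloid_def midpt_def lor_add power_divide)
qed

lemma triple_midpt: assumes "a \<in> hyperboloid" "b \<in> hyperboloid" shows "triple (midpt a b) (bar a) = b"
proof -
  let ?N = "2 + 2 * (a \<bullet> bar b)"
  have p: "0 < a \<bullet> bar b" using inner_bar_pos hyp_fcone assms by blast
  have "2 * (midpt a b \<bullet> bar a) * (1 / sqrt ?N) = 2 * (1 + a \<bullet> bar b) / (sqrt ?N * sqrt ?N)"
    using hypD[OF assms(1)] inner_bar[of a b] inner_commute[of b "bar a"]
    by (simp add: midpt_def inner_add_left lorentz_def)
  also have "\<dots> = 1" using p by simp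
  finally have k: "2 * (midpt a b \<bullet> bar a) * (1 / sqrt ?N) = 1" .
  have "r *\<^sub>R midpt a b = (r * (1 / sqrt ?N)) *\<^sub>R (a + b)" for r
    by (simp add: midpt_def)
  from this[of "2 * (midpt a b \<bullet> bar a)"]
  have "(2 * (midpt a b \<bullet> bar a)) *\<^sub>R midpt a b = a + b"
    unfolding k by simp
  then show ?thesis using hypD[OF midpt_hyp[OF assms]] by (simp add: triple_def)
qed

text \<open>The equation says that \<open>a + b\<close> is a multiple of \<open>x\<close>, and a ray meets the hyperboloid once. Since
  the equation is written in terms of the triple product, homomorphisms preserve midpoints.\<close>
lemma midpt_unique:
  assumes "a \<in> hyperboloid" "b \<in> hyperboloid" "x \<in> hyperboloid" "triple x (bar a) = b" shows "x = midpt a b"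
proof -
  have e: "(2 * (x \<bullet> bar a)) *\<^sub>R x = a + b"
    using assms hypD[of x] by (auto simp: triple_def)
  have "((1 / sqrt (2 + 2 * (a \<bullet> bar b))) * (2 * (x \<bullet> bar a))) *\<^sub>R x = midpt a b"
    unfolding midpt_def e[symmetric] by simp
  then show ?thesis using hyp_scaleR_eq assms midpt_hyp by blast
qed

section \<open>Functional equations in one real variable\<close>

text \<open>The difference \<open>D x = L x - x L 1\<close> is additive and vanishes at \<open>1\<close>, so it has period one and is
  bounded on the whole half-line; a bounded additive function is zero.\<close>
lemma additive_bounded_imp_linear:
  fixes L :: "real \<Rightarrow> real"
  assumes add: "\<And>x y. 0 \<le> x \<Longrightarrow> 0 \<le> y \<Longrightarrow> L (x + y) = L x + L y"
    and bd: "\<And>x. 0 \<le> x \<Longrightarrow> x \<le> 1 \<Longrightarrow> \<bar>L x\<bar> \<le> M"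
    and x: "0 \<le> x"
  shows "L x = x * L 1"
proof -
  define D where "D x = L x - x * L 1" for x
  have D_add: "D (x + y) = D x + D y" if "0 \<le> x" "0 \<le> y" for x y
    using add[OF that] by (simp add: D_def algebra_simps)
  have D0: "D 0 = 0" using D_add[of 0 0] by simp
  have D_mult: "D (real n * y) = real n * D y" if "0 \<le> y" for n y
  proof (induction n)
    case 0 then show ?case by (simp add: D0)
  next
    case (Suc n)
    have "D (real (Suc n) * y) = D (real n * y + y)" by (simp add: algebra_simps)
    also have "\<dots> = D (real n * y) + D y" using that by (intro D_add) auto
    finally show ?case using Suc by (simp add: algebra_simps)
  qed
  have D_bound: "\<bar>D y\<bar> \<le> M + \<bar>L 1\<bar>" if y: "0 \<le> y" for y
  proof -
    define n where "n = nat \<lfloor>y\<rfloor>"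
    have n: "real n = of_int \<lfloor>y\<rfloor>" using y by (simp add: n_def)
    have f: "0 \<le> frac y" "frac y \<le> 1" using frac_lt_1[of y] by auto
    have "y = real n * 1 + frac y" by (simp add: n frac_def)
    then have "D y = D (real n * 1 + frac y)" by simp
    also have "\<dots> = D (real n * 1) + D (frac y)" using f by (intro D_add) auto
    also have "\<dots> = D (frac y)" by (subst D_mult) (auto simp: D_def)
    finally have "\<bar>D y\<bar> \<le> \<bar>L (frac y)\<bar> + \<bar>frac y * L 1\<bar>" unfolding D_def by linarith
    also have "\<dots> \<le> M + 1 * \<bar>L 1\<bar>"
      unfolding abs_mult using f by (intro add_mono bd mult_right_mono) auto
    finally show ?thesis by simp
  qed
  have "D x = 0"
  proof (rule ccontr)
    assume "D x \<noteq> 0"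
    then obtain n where "M + \<bar>L 1\<bar> < real n * \<bar>D x\<bar>"
      using reals_Archimedean3[of "\<bar>D x\<bar>"] by auto
    also have "\<dots> = \<bar>D (real n * x)\<bar>" using D_mult[OF x] by (simp add: abs_mult)
    finally show False using D_bound[of "real n * x"] x by simp
  qed
  then show ?thesis by (simp add: D_def)
qed

text \<open>A multiplicative \<open>G \<ge> 1\<close> is monotone, hence a power \<open>u powr c\<close>. Comparing both sides of the doubling
  formula for large \<open>u\<close> gives \<open>2 powr c = 2\<close> unless \<open>c = 0\<close>.\<close>
lemma multiplicative_doubling_dichotomy:
  fixes G :: "real \<Rightarrow> real"
  assumes ge1: "\<And>u. 1 \<le> u \<Longrightarrow> 1 \<le> G u"
    and mult: "\<And>u v. 1 \<le> u \<Longrightarrow> 1 \<le> v \<Longrightarrow> G (u * v) = G u * G v"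
    and dup: "\<And>u. 1 \<le> u \<Longrightarrow> G (2 * u\<^sup>2 - 1) = 2 * (G u)\<^sup>2 - 1"
  shows "(\<forall>u\<ge>1. G u = 1) \<or> (\<forall>u\<ge>1. G u = u)"
proof -
  define L where "L x = ln (G (exp x))" for x
  have L_add: "L (x + y) = L x + L y" if "0 \<le> x" "0 \<le> y" for x y
    using mult[of "exp x" "exp y"] ge1[of "exp x"] ge1[of "exp y"] that
    by (simp add: L_def exp_add ln_mult)
  have L_nonneg: "0 \<le> L x" if "0 \<le> x" for x using ge1[of "exp x"] that by (simp add: L_def)
  have "\<bar>L x\<bar> \<le> L 1" if "0 \<le> x" "x \<le> 1" for x
    using L_add[of x "1 - x"] L_nonneg[of x] L_nonneg[of "1 - x"] that by simp
  then have L_lin: "L x = x * L 1" if "0 \<le> x" for x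
    using additive_bounded_imp_linear[of L "L 1" x] L_add that by blast
  define c where "c = L 1"
  have G: "G u = u powr c" if "1 \<le> u" for u
  proof -
    have "ln (G u) = ln u * c" using L_lin[of "ln u"] that by (simp add: L_def c_def)
    then show ?thesis using ge1[OF that] that by (metis exp_ln less_le_trans mult.commute
      powr_def zero_less_one not_one_le_zero)
  qed
  have "0 \<le> c" using L_nonneg[of 1] by (simp add: c_def)
  then consider "c = 0" | "0 < c" by linarith
  then show ?thesis
  proof cases
    case 1 then show ?thesis using G by auto
  next
    case 2
    \<comment> \<open>The doubling formula for \<open>u\<^sup>2 = 1 / y\<close>, multiplied by \<open>y powr c\<close>, so that large \<open>u\<close> becomes \<open>y \<rightarrow> 0\<close>.\<close>
    have eq: "(2 - y) powr c = 2 - y powr c" if y: "0 < y" "y < 1" for y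
    proof -
      define u where "u = sqrt (1 / y)"
      have u: "u\<^sup>2 = 1 / y" "1 \<le> u" "0 < u" using y by (auto simp: u_def)
      have "1 \<le> 2 * u\<^sup>2 - 1" using u(2) one_le_power[of u 2] by linarith
      then have "(2 * u\<^sup>2 - 1) powr c = 2 * (u powr c)\<^sup>2 - 1"
        using dup[OF u(2)] G u(2) by metis
      also have "(u powr c)\<^sup>2 = (u\<^sup>2) powr c"
        using u(3) by (simp add: powr_powr mult.commute flip: powr_numeral)
      finally have e: "(2 / y - 1) powr c = 2 * (1 / y) powr c - 1" by (simp add: u)
      have "(2 - y) powr c = (y * (2 / y - 1)) powr c" using y by (simp add: right_diff_distrib)
      also have "\<dots> = y powr c * (2 / y - 1) powr c" using y by (simp add: powr_mult)
      also have "\<dots> = 2 * (y powr c * (1 / y) powr c) - y powr c" unfolding e by (simp add: algebra_simps)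
      also have "y powr c * (1 / y) powr c = 1" using y by (simp flip: powr_mult)
      finally show ?thesis by simp
    qed
    have l1: "((\<lambda>y. (2 - y) powr c) \<longlongrightarrow> (2 - 0) powr c) (at_right (0::real))"
      by (intro tendsto_intros) auto
    have l2: "((\<lambda>y. 2 - y powr c) \<longlongrightarrow> 2 - 0) (at_right (0::real))"
      using 2 by (intro tendsto_diff tendsto_const tendsto_zero_powrI tendsto_ident_at)
        (auto simp: eventually_at_right_less intro: eventually_mono[OF eventually_at_right_less])
    have "\<forall>\<^sub>F y in at_right 0. (2 - y) powr c = 2 - y powr c"
      using eventually_at_right_real[OF zero_less_one] by (rule eventually_mono) (auto simp: eq)
    then have "((\<lambda>y. 2 - y powr c) \<longlongrightarrow> (2 - 0) powr c) (at_right (0::real))"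
      using l1 by (rule Lim_transform_eventually[rotated])
    then have "2 powr c = (2::real)"
      using tendsto_unique[OF _ _ l2] by (simp add: trivial_limit_at_right_real)
    then have "c = 1" by (metis powr_inj powr_one numeral_One numeral_eq_iff semiring_norm(85)
          zero_less_numeral zero_le_numeral)
    then show ?thesis using G by auto
  qed
qed

text \<open>The equation with \<open>t = 1\<close> turns the square into an arbitrary argument, so that \<open>p\<close> is a
  homomorphism of the multiplicative group; in logarithmic coordinates it is additive.\<close>
lemma continuous_square_multiplicative_imp_powr:
  fixes p :: "real \<Rightarrow> real"
  assumes pos: "\<And>t. 0 < t \<Longrightarrow> 0 < p t"
    and hom: "\<And>s t. 0 < s \<Longrightarrow> 0 < t \<Longrightarrow> p (s\<^sup>2 * t) = (p s)\<^sup>2 * p t"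
    and cont: "continuous_on {0<..} p"
  obtains c where "\<And>t. 0 < t \<Longrightarrow> p t = t powr c"
proof -
  have p1: "p 1 = 1"
  proof -
    have "(p 1)\<^sup>2 = 1" using hom[of 1 1] pos[of 1] by simp
    then show ?thesis using pos[of 1] by (simp add: power2_eq_1_iff)
  qed
  have mult: "p (s * t) = p s * p t" if "0 < s" "0 < t" for s t
    using hom[of "sqrt s" t] hom[of "sqrt s" 1] that by (simp add: p1)
  define L where "L x = ln (p (exp x))" for x
  have L_add: "L (x + y) = L x + L y" for x y
    using mult[of "exp x" "exp y"] pos[of "exp x"] pos[of "exp y"]
    by (simp add: L_def exp_add ln_mult)
  have "continuous_on {0..1} L"
    unfolding L_def
    by (intro continuous_intros continuous_on_compose2[OF cont]) (auto simp: pos less_imp_neq[symmetric])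
  then have "bounded (L ` {0..1})"
    by (intro compact_imp_bounded compact_continuous_image) auto
  then obtain M where "\<forall>x\<in>{0..1}. \<bar>L x\<bar> \<le> M"
    unfolding bounded_iff by auto
  then have M: "\<bar>L x\<bar> \<le> M" if "0 \<le> x" "x \<le> 1" for x
    using that by simp
  have L_nonneg: "L x = x * L 1" if "0 \<le> x" for x
    using additive_bounded_imp_linear[of L M x] L_add M that by blast
  have L_lin: "L x = x * L 1" for x
  proof (cases "0 \<le> x")
    case False
    have "L x + L (- x) = 0" using L_add[of x "- x"] L_nonneg[of 0] by simp
    then show ?thesis using L_nonneg[of "- x"] False by simp
  qed (rule L_nonneg)
  have "p t = t powr L 1" if "0 < t" for t
  proof -
    have "ln (p t) = ln t * L 1" using L_lin[of "ln t"] that by (simp add: L_def)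
    then show ?thesis using pos[OF that] that by (metis exp_ln mult.commute powr_def less_irrefl)
  qed
  then show ?thesis using that by blast
qed

section \<open>Midpoints of points that move to infinity\<close>

lemma compact_hyp_slice:
  fixes R :: real shows "compact {a \<in> (hyperboloid :: (real \<times> 'a::euclidean_space) set). fst a \<le> R}" (is "compact ?S")
proof -
  have "?S = {a. 1 \<le> fst a} \<inter> {a. lorentz a = 1} \<inter> {a. fst a \<le> R}"
    by (auto dest: hypD(1)) (auto simp: hyperboloid_def)
  moreover have "closed {a :: real \<times> 'a. lorentz a = 1}"
    unfolding lor_eq by (intro closed_Collect_eq continuous_intros)
  moreover have "closed {a :: real \<times> 'a. 1 \<le> fst a}" "closed {a :: real \<times> 'a. fst a \<le> R}"
    by (intro closed_Collect_le continuous_intros)+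
  ultimately have "closed ?S" by auto
  moreover have "bounded ?S"
  proof (rule boundedI)
    fix a :: "real \<times> 'a" assume a: "a \<in> ?S"
    then have a1: "1 \<le> fst a" "fst a \<le> R" "snd a \<bullet> snd a = (fst a)\<^sup>2 - 1" using hypD[of a] by auto
    have "(norm (snd a))\<^sup>2 \<le> (fst a)\<^sup>2" using a1 by (simp add: power2_norm_eq_inner)
    then have "norm (snd a) \<le> fst a" using a1 by (meson power2_le_imp_le order_trans zero_le_one)
    moreover have "norm a \<le> norm (fst a) + norm (snd a)"
      by (metis norm_Pair_le prod.collapse)
    ultimately show "norm a \<le> 2 * R" using a1 by simp
  qed
  ultimately show ?thesis by (simp add: compact_eq_bounded_closed)
qed

lemma midpt_fst_sq:
  assumes "a \<in> hyperboloid" "b \<in> hyperboloid"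
  shows "(fst (midpt a b))\<^sup>2 = (fst a + fst b)\<^sup>2 / (2 + 2 * (a \<bullet> bar b))"
  using inner_bar_pos[OF hyp_fcone[OF assms(1)] hyp_fcone[OF assms(2)]]
  by (simp add: midpt_def power_divide)

text \<open>As \<open>a \<bullet> bar b\<close> is less than \<open>2 fst a fst b\<close>, the normalization divides by at most a multiple of the
  geometric mean of the two coordinates. So the midpoint is far out if one point is much farther out than the other.\<close>
lemma midpt_fst_lower:
  assumes a: "a \<in> hyperboloid" and b: "b \<in> hyperboloid"
  shows "fst a / fst b \<le> 6 * (fst (midpt a b))\<^sup>2"
proof -
  let ?a = "fst a" and ?b = "fst b"
  have ab: "1 \<le> ?a" "1 \<le> ?b" using a b hypD by blast+
  have p: "0 < a \<bullet> bar b" using inner_bar_pos hyp_fcone a b by blast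
  have "1 * 1 \<le> ?a * ?b" using ab by (intro mult_mono) auto
  moreover have "a \<bullet> bar b \<le> 2 * (?a * ?b)"
    using abs_inner_snd_less[OF hyp_fcone[OF a] hyp_fcone[OF b]] by (simp add: inner_prod_def)
  ultimately have d: "2 + 2 * (a \<bullet> bar b) \<le> 6 * (?a * ?b)" by linarith
  have "?a / ?b = 6 * (?a\<^sup>2 / (6 * (?a * ?b)))" using ab by (simp add: power2_eq_square)
  also have "\<dots> \<le> 6 * ((?a + ?b)\<^sup>2 / (2 + 2 * (a \<bullet> bar b)))"
    using ab p d by (intro mult_left_mono frac_le power_mono) auto
  finally show ?thesis using midpt_fst_sq[OF a b] by simp
qed

text \<open>Two points at the same distance from the origin, seen from it under an angle with cosine \<open>\<kappa>\<close>, have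
  a midpoint whose distance from the origin is bounded in terms of \<open>\<kappa>\<close> alone: the segment between them
  stays within bounded distance of the origin however far out they are.\<close>
lemma midpt_fst_upper:
  assumes a: "a \<in> hyperboloid" and b: "b \<in> hyperboloid" and eq: "fst a = fst b"
    and k: "snd a \<bullet> snd b = \<kappa> * (snd a \<bullet> snd a)" "- 1 \<le> \<kappa>" "\<kappa> < 1"
  shows "(fst (midpt a b))\<^sup>2 \<le> 2 / (1 - \<kappa>)"
proof -
  have p: "0 < a \<bullet> bar b" using inner_bar_pos hyp_fcone a b by blast
  have a1: "1 \<le> fst a" using a hypD by blast
  have "2 + 2 * (a \<bullet> bar b) = 2 + 2 * \<kappa> + 2 * (1 - \<kappa>) * (fst a)\<^sup>2"
    using k(1) hypD[OF a] eq by (simp add: inner_prod_def power2_eq_square algebra_simps)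
  then have d: "2 * (1 - \<kappa>) * (fst a)\<^sup>2 \<le> 2 + 2 * (a \<bullet> bar b)" using k by linarith
  have "(fst (midpt a b))\<^sup>2 = 4 * (fst a)\<^sup>2 / (2 + 2 * (a \<bullet> bar b))"
    using midpt_fst_sq[OF a b] by (simp add: power2_eq_square flip: eq)
  also have "\<dots> \<le> 4 * (fst a)\<^sup>2 / (2 * (1 - \<kappa>) * (fst a)\<^sup>2)"
    using d a1 k p by (intro divide_left_mono mult_pos_pos) auto
  also have "\<dots> = 2 / (1 - \<kappa>)" using a1 k by (simp add: field_simps)
  finally show ?thesis .
qed

definition sq :: "real \<times> 'a::real_inner \<Rightarrow> real \<times> 'a" where
  "sq a = triple a one"

lemma sq_hyp: "a \<in> hyperboloid \<Longrightarrow> sq a \<in> hyperboloid"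
  by (simp add: sq_def triple_hyp)

lemma sq_iter_hyp: "a \<in> hyperboloid \<Longrightarrow> (sq ^^ n) a \<in> hyperboloid"
  by (induction n) (auto simp: sq_hyp)

lemma snd_sq: "snd (sq a) = (2 * fst a) *\<^sub>R snd a"
  by (simp add: sq_def triple_one_right)

lemma fst_sq: "a \<in> hyperboloid \<Longrightarrow> fst (sq a) = 2 * (fst a)\<^sup>2 - 1"
  by (simp add: sq_def triple_one_right hypD power2_eq_square)

text \<open>Squaring moves a point along its geodesic ray from the origin, with a factor that depends only on the distance.\<close>
lemma sq_iter_parallel:
  assumes "a \<in> hyperboloid" "b \<in> hyperboloid" "fst a = fst b"
  obtains r where "snd ((sq ^^ n) a) = r *\<^sub>R snd a" "snd ((sq ^^ n) b) = r *\<^sub>R snd b"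
    "fst ((sq ^^ n) a) = fst ((sq ^^ n) b)"
proof -
  have "\<exists>r. snd ((sq ^^ n) a) = r *\<^sub>R snd a \<and> snd ((sq ^^ n) b) = r *\<^sub>R snd b \<and>
    fst ((sq ^^ n) a) = fst ((sq ^^ n) b)"
  proof (induction n)
    case 0 show ?case by (intro exI[of _ 1]) (simp add: assms)
  next
    case (Suc n)
    then obtain r where r: "snd ((sq ^^ n) a) = r *\<^sub>R snd a" "snd ((sq ^^ n) b) = r *\<^sub>R snd b"
      "fst ((sq ^^ n) a) = fst ((sq ^^ n) b)" by blast
    show ?case
      using r by (intro exI[of _ "2 * fst ((sq ^^ n) a) * r"])
        (simp add: snd_sq fst_sq sq_iter_hyp assms)
  qed
  then show ?thesis using that by blast
qed

text \<open>The ratio of the first coordinates at least squares in each step, because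
  \<open>(2 x\<^sup>2 - 1) / (2 y\<^sup>2 - 1) \<ge> (x / y)\<^sup>2\<close> for \<open>x \<ge> y \<ge> 1\<close>.\<close>
lemma sq_iter_ratio:
  assumes a: "a \<in> hyperboloid" and b: "b \<in> hyperboloid" and r: "1 \<le> r" "r * fst b \<le> fst a"
  shows "r ^ Suc n * fst ((sq ^^ n) b) \<le> fst ((sq ^^ n) a)"
proof (induction n)
  case 0 then show ?case using r by simp
next
  case (Suc n)
  let ?a = "fst ((sq ^^ n) a)" and ?b = "fst ((sq ^^ n) b)"
  have b1: "1 \<le> ?b" using sq_iter_hyp[OF b] hypD by blast
  have q: "1 \<le> r ^ Suc (Suc n)" using r by (simp only: one_le_power)
  have "r ^ Suc (Suc n) \<le> (r ^ Suc n)\<^sup>2"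
    unfolding power_mult[symmetric] using r by (intro power_increasing) auto
  then have "r ^ Suc (Suc n) * (2 * ?b\<^sup>2) \<le> (r ^ Suc n)\<^sup>2 * (2 * ?b\<^sup>2)"
    by (intro mult_right_mono) auto
  also have "\<dots> = 2 * (r ^ Suc n * ?b)\<^sup>2" by (simp add: power_mult_distrib)
  also have "\<dots> \<le> 2 * ?a\<^sup>2"
    using Suc b1 r by (intro mult_left_mono power_mono) (auto intro!: mult_nonneg_nonneg)
  finally have "r ^ Suc (Suc n) * (2 * ?b\<^sup>2 - 1) \<le> 2 * ?a\<^sup>2 - 1"
    using q unfolding right_diff_distrib by linarith
  then show ?case by (simp add: fst_sq sq_iter_hyp a b del: power_Suc)
qed

section \<open>Rigidity of triple homomorphisms of the hyperboloid\<close>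

lemma ex_orthonormal_pair:
  assumes "2 \<le> DIM('a)"
  obtains e1 e2 :: "'a::euclidean_space" where "e1 \<bullet> e1 = 1" "e2 \<bullet> e2 = 1" "e1 \<bullet> e2 = 0"
proof -
  obtain B where "B \<subseteq> (Basis :: 'a set)" "card B = 2"
    using assms obtain_subset_with_card_n by metis
  then obtain e1 e2 where "e1 \<in> (Basis :: 'a set)" "e2 \<in> Basis" "e1 \<noteq> e2"
    by (auto simp: card_2_iff)
  then show ?thesis using that[of e1 e2] by (simp add: inner_Basis)
qed

locale hyp_triple_hom =
  fixes \<psi> :: "real \<times> 'a::euclidean_space \<Rightarrow> real \<times> 'a"
  assumes maps: "a \<in> hyperboloid \<Longrightarrow> \<psi> a \<in> hyperboloid"
    and hom: "a \<in> hyperboloid \<Longrightarrow> b \<in> hyperboloid \<Longrightarrow> \<psi> (triple a b) = triple (\<psi> a) (\<psi> b)"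
    and cont: "continuous_on hyperboloid \<psi>"
    and dim: "2 \<le> DIM('a)"
begin

lemma psi_one: "\<psi> one = one"
proof -
  have "triple (\<psi> one) (\<psi> one) = \<psi> one"
    using hom[OF one_hyp one_hyp] triple_bar[OF one_hyp, where 'a='a] by simp
  then have "\<psi> one = bar (\<psi> one)" by (intro triple_eq_self_imp_bar maps) auto
  then have "snd (\<psi> one) = - snd (\<psi> one)" by (metis snd_bar)
  then have "2 *\<^sub>R snd (\<psi> one) = 0" unfolding scaleR_2 eq_neg_iff_add_eq_0 .
  then have s: "snd (\<psi> one) = 0" by simp
  have "(fst (\<psi> one))\<^sup>2 = 1" "1 \<le> fst (\<psi> one)" using hypD[OF maps[OF one_hyp]] s by auto
  then have "fst (\<psi> one) = 1" by (simp add: power2_eq_1_iff)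
  then show ?thesis using s by (simp add: prod_eq_iff)
qed

lemma psi_bar: assumes "a \<in> hyperboloid" shows "\<psi> (bar a) = bar (\<psi> a)"
  using hom[of a "bar a"] triple_bar[OF assms] assms
  by (intro triple_eq_self_imp_bar) (auto simp: maps)

lemma psi_midpt: assumes "a \<in> hyperboloid" "b \<in> hyperboloid" shows "\<psi> (midpt a b) = midpt (\<psi> a) (\<psi> b)"
  using hom[of "midpt a b" "bar a"] triple_midpt[OF assms] maps[OF assms(1)] maps[OF assms(2)] assms
  by (intro midpt_unique maps midpt_hyp) (simp_all add: midpt_hyp psi_bar)

lemma psi_sq_iter: "a \<in> hyperboloid \<Longrightarrow> \<psi> ((sq ^^ n) a) = (sq ^^ n) (\<psi> a)"
proof (induction n)
  case (Suc n)
  then show ?case using hom[of "(sq ^^ n) a" one] by (simp add: sq_iter_hyp psi_one flip: sq_def)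
qed simp

lemma fst_psi_bounded: obtains S where "\<And>a. a \<in> hyperboloid \<Longrightarrow> fst a \<le> R \<Longrightarrow> fst (\<psi> a) \<le> S"
proof -
  let ?S = "{a \<in> (hyperboloid :: (real \<times> 'a) set). fst a \<le> R}"
  have "compact (\<psi> ` ?S)"
    using cont by (intro compact_continuous_image compact_hyp_slice) (auto elim: continuous_on_subset)
  then have "bounded (\<psi> ` ?S)" by (rule compact_imp_bounded)
  then obtain K where K: "\<And>x. x \<in> \<psi> ` ?S \<Longrightarrow> norm x \<le> K"
    unfolding bounded_iff by blast
  have "fst (\<psi> a) \<le> K" if "a \<in> hyperboloid" "fst a \<le> R" for a
  proof -
    have "norm (fst (\<psi> a)) \<le> norm (\<psi> a)" by (metis norm_fst_le prod.collapse)
    also have "\<dots> \<le> K" using K that by blast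
    finally show ?thesis by simp
  qed
  then show ?thesis using that by blast
qed

text \<open>If the inequality failed, the
  squared iterates of the images have first coordinates with unbounded ratio, so their midpoints are
  unbounded by \<open>midpt_fst_lower\<close>; but they are images of the midpoints of the iterates of \<open>a\<close> and \<open>b\<close>,
  which stay in a compact set by \<open>midpt_fst_upper\<close>.\<close>
lemma fst_psi_le:
  assumes a: "a \<in> hyperboloid" and b: "b \<in> hyperboloid" and eq: "fst a = fst b"
  shows "fst (\<psi> a) \<le> fst (\<psi> b)"
proof (cases "snd a = snd b")
  case True then show ?thesis using eq by (metis prod_eq_iff order_refl)
next
  case False
  define \<kappa> where "\<kappa> = (snd a \<bullet> snd b) / (snd a \<bullet> snd a)"
  have nn: "snd a \<bullet> snd a = snd b \<bullet> snd b" using hypD[OF a] hypD[OF b] eq by simp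
  have "snd a \<noteq> 0"
  proof
    assume 0: "snd a = 0"
    then have "snd b = 0" using nn by simp
    then show False using 0 False by simp
  qed
  then have pos: "0 < snd a \<bullet> snd a" by simp
  have "0 < (snd a - snd b) \<bullet> (snd a - snd b)" using False by simp
  then have k1: "\<kappa> < 1" using pos nn
    by (simp add: \<kappa>_def inner_diff_left inner_diff_right inner_commute)
  have "0 \<le> (snd a + snd b) \<bullet> (snd a + snd b)" by simp
  then have k2: "- 1 \<le> \<kappa>" using pos nn
    by (simp add: \<kappa>_def inner_add_left inner_add_right inner_commute pos_le_divide_eq)
  have k3: "snd a \<bullet> snd b = \<kappa> * (snd a \<bullet> snd a)" using pos by (simp add: \<kappa>_def)
  let ?a = "\<lambda>n. (sq ^^ n) a" and ?b = "\<lambda>n. (sq ^^ n) b"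
  define R where "R = max 1 (2 / (1 - \<kappa>))"
  have m: "fst (midpt (?a n) (?b n)) \<le> R" for n
  proof -
    obtain r where r: "snd (?a n) = r *\<^sub>R snd a" "snd (?b n) = r *\<^sub>R snd b" "fst (?a n) = fst (?b n)"
      using sq_iter_parallel[OF a b eq] .
    have "snd (?a n) \<bullet> snd (?b n) = \<kappa> * (snd (?a n) \<bullet> snd (?a n))" by (simp add: r k3)
    then have "(fst (midpt (?a n) (?b n)))\<^sup>2 \<le> 2 / (1 - \<kappa>)"
      by (intro midpt_fst_upper sq_iter_hyp a b r k2 k1)
    also have "\<dots> \<le> R * R"
    proof -
      have R: "2 / (1 - \<kappa>) \<le> R" "1 \<le> R" by (simp_all add: R_def)
      moreover from R(2) have "R * 1 \<le> R * R" by (intro mult_left_mono) auto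
      ultimately show ?thesis by linarith
    qed
    finally show ?thesis unfolding power2_eq_square[symmetric]
      by (rule power2_le_imp_le) (simp add: R_def)
  qed
  obtain S where S: "\<And>a. a \<in> hyperboloid \<Longrightarrow> fst a \<le> R \<Longrightarrow> fst (\<psi> a) \<le> S"
    using fst_psi_bounded by blast
  show ?thesis
  proof (rule ccontr)
    assume neg: "\<not> fst (\<psi> a) \<le> fst (\<psi> b)"
    define r where "r = fst (\<psi> a) / fst (\<psi> b)"
    have pb: "1 \<le> fst (\<psi> b)" using hypD maps b by blast
    then have r: "1 < r" "r * fst (\<psi> b) = fst (\<psi> a)" using neg by (auto simp: r_def)
    have bound: "r ^ Suc n \<le> 6 * S\<^sup>2" for n
    proof -
      let ?A = "(sq ^^ n) (\<psi> a)" and ?B = "(sq ^^ n) (\<psi> b)"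
      have AB: "?A \<in> hyperboloid" "?B \<in> hyperboloid" using a b by (auto intro: sq_iter_hyp maps)
      have "r ^ Suc n * fst ?B \<le> fst ?A" using a b r by (intro sq_iter_ratio maps) auto
      then have "r ^ Suc n \<le> fst ?A / fst ?B" using hypD(1)[OF AB(2)] by (simp add: pos_le_divide_eq)
      also have "\<dots> \<le> 6 * (fst (midpt ?A ?B))\<^sup>2" by (rule midpt_fst_lower[OF AB])
      also have "midpt ?A ?B = \<psi> (midpt (?a n) (?b n))"
        using a b by (simp add: psi_midpt sq_iter_hyp psi_sq_iter)
      also have "6 * (fst (\<psi> (midpt (?a n) (?b n))))\<^sup>2 \<le> 6 * S\<^sup>2"
      proof -
        have h: "midpt (?a n) (?b n) \<in> hyperboloid" using a b by (simp add: midpt_hyp sq_iter_hyp)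
        then show ?thesis using S[OF h m] hypD(1)[OF maps[OF h]]
          by (intro mult_left_mono power_mono) auto
      qed
      finally show ?thesis .
    qed
    obtain n where "6 * S\<^sup>2 < r ^ n" using real_arch_pow[OF r(1)] by blast
    also have "\<dots> \<le> r ^ Suc n" using r by (intro power_increasing) auto
    finally show False using bound[of n] by simp
  qed
qed

text \<open>By \<open>fst_psi_le\<close> the first coordinate of \<open>\<psi> a\<close> is a function \<open>G\<close> of that of \<open>a\<close>. The
  inner product \<open>a \<bullet> b\<close> is the first coordinate of \<open>triple s b\<close> for a square root \<open>s\<close> of \<open>a\<close>, so
  inner products transform by \<open>G\<close> too. The midpoint formula for isosceles triangles is then
  the multiplicativity of \<open>G\<close>.\<close>
proposition rigidity:
  shows "(\<forall>a\<in>hyperboloid. \<psi> a = one) \<or> (\<forall>a\<in>hyperboloid. \<forall>b\<in>hyperboloid. \<psi> a \<bullet> \<psi> b = a \<bullet> b)"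
proof -
  obtain e1 e2 :: 'a where e: "e1 \<bullet> e1 = 1" "e2 \<bullet> e2 = 1" "e1 \<bullet> e2 = 0" "e2 \<bullet> e1 = 0"
    using ex_orthonormal_pair[OF dim] inner_commute by metis
  define ray :: "real \<Rightarrow> real \<times> 'a" where "ray u = (u, sqrt (u\<^sup>2 - 1) *\<^sub>R e1)" for u
  have ray: "ray u \<in> hyperboloid" "fst (ray u) = u" if "1 \<le> u" for u
    using that one_le_power[OF that, of 2] by (auto simp: ray_def hyperboloid_def lor_eq e)
  define G where "G u = fst (\<psi> (ray u))" for u
  have G: "fst (\<psi> a) = G (fst a)" if "a \<in> hyperboloid" for a
    using fst_psi_le[of a "ray (fst a)"] fst_psi_le[of "ray (fst a)" a] ray[of "fst a"] hypD(1)[OF that] that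
    by (force simp: G_def)
  have G_ge: "1 \<le> G u" if "1 \<le> u" for u
    using hypD(1)[OF maps[OF ray(1)[OF that]]] by (simp add: G_def)
  have G_dup: "G (2 * u\<^sup>2 - 1) = 2 * (G u)\<^sup>2 - 1" if u: "1 \<le> u" for u
    using G[OF sq_hyp[OF ray(1)[OF u]]] psi_sq_iter[OF ray(1)[OF u], of 1] ray[OF u]
    by (simp add: fst_sq maps G_def)
  \<comment> \<open>The midpoint of the origin and \<open>a\<close> is the square root of \<open>a\<close>.\<close>
  have G_inner: "\<psi> a \<bullet> \<psi> b = G (a \<bullet> b)" if a: "a \<in> hyperboloid" and b: "b \<in> hyperboloid" for a b
  proof -
    define s where "s = midpt one a"
    have s: "s \<in> hyperboloid" "triple s one = a"
      using midpt_hyp[OF one_hyp a] triple_midpt[OF one_hyp a] by (simp_all add: s_def)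
    have "\<psi> a = triple (\<psi> s) one" using hom[OF s(1) one_hyp] s psi_one by simp
    then have "\<psi> a \<bullet> \<psi> b = fst (\<psi> (triple s b))" by (simp add: inner_triple_one hom s b)
    also have "\<dots> = G (triple s one \<bullet> b)" by (simp add: G triple_hyp s(1) b inner_triple_one)
    finally show ?thesis by (simp add: s)
  qed
  have G_mult: "G (u * v) = G u * G v" if u: "1 \<le> u" and v: "1 \<le> v" for u v
  proof -
    \<comment> \<open>An isosceles triangle with apex at the origin, height \<open>arcosh u\<close> and half base \<open>arcosh v\<close>; its legs have length \<open>arcosh (u v)\<close>.\<close>
    define p where "p = v * sqrt (u\<^sup>2 - 1)"
    define q where "q = sqrt (v\<^sup>2 - 1)"
    have p2: "p * p = v\<^sup>2 * (u\<^sup>2 - 1)" and q2: "q * q = v\<^sup>2 - 1"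
      using one_le_power[OF u, of 2] one_le_power[OF v, of 2]
      by (auto simp: p_def q_def power2_eq_square algebra_simps)
    define a where "a = (u * v, p *\<^sub>R e1 + q *\<^sub>R e2)"
    define b where "b = (u * v, p *\<^sub>R e1 - q *\<^sub>R e2)"
    have uv: "0 < u * v" using u v by simp
    have ab: "a \<in> hyperboloid" "b \<in> hyperboloid"
      using uv by (auto simp: a_def b_def hyperboloid_def lor_eq inner_add_left inner_add_right
          inner_diff_left inner_diff_right e p2 q2 algebra_simps power_mult_distrib)
    have ip: "a \<bullet> bar b = 2 * v\<^sup>2 - 1"
      by (simp add: a_def b_def inner_prod_def inner_add_left inner_add_right
          inner_diff_left inner_diff_right e p2 q2 algebra_simps power2_eq_square)
    have f: "fst a = u * v" "fst b = u * v" by (simp_all add: a_def b_def)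
    have "(fst (midpt a b))\<^sup>2 = (2 * (u * v))\<^sup>2 / (4 * v\<^sup>2)"
      by (simp add: midpt_fst_sq ab ip f)
    then have "(fst (midpt a b))\<^sup>2 = u\<^sup>2" using v by (simp add: power_mult_distrib)
    then have m: "fst (midpt a b) = u"
      by (rule power2_eq_imp_eq) (use u hypD(1)[OF midpt_hyp[OF ab]] in auto)
    have Gv: "1 \<le> G v" "1 \<le> G u" "1 \<le> G (u * v)" using G_ge u v mult_mono[OF u v] by auto
    have "\<psi> a \<bullet> bar (\<psi> b) = 2 * (G v)\<^sup>2 - 1"
      using G_inner[of a "bar b"] ab by (simp add: psi_bar ip G_dup v)
    then have "(fst (midpt (\<psi> a) (\<psi> b)))\<^sup>2 = (2 * G (u * v))\<^sup>2 / (4 * (G v)\<^sup>2)"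
      by (simp add: midpt_fst_sq maps ab G f)
    then have "(fst (midpt (\<psi> a) (\<psi> b)))\<^sup>2 = (G (u * v))\<^sup>2 / (G v)\<^sup>2"
      by (simp add: power_mult_distrib)
    moreover have "fst (midpt (\<psi> a) (\<psi> b)) = G u"
      using G[OF midpt_hyp[OF ab]] by (simp add: psi_midpt ab m)
    ultimately have "(G (u * v))\<^sup>2 = (G u * G v)\<^sup>2"
      using Gv by (simp add: field_simps power_mult_distrib)
    then show ?thesis by (rule power2_eq_imp_eq) (use Gv in auto)
  qed
  have ip_ge: "1 \<le> a \<bullet> b" if "a \<in> hyperboloid" "b \<in> hyperboloid" for a b :: "real \<times> 'a"
  proof -
    have h: "midpt one a \<in> hyperboloid" "triple (midpt one a) one = a"
      using midpt_hyp[OF one_hyp that(1)] triple_midpt[OF one_hyp that(1)]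
      by simp_all
    show ?thesis using hypD(1)[OF triple_hyp[OF h(1) that(2)]] inner_triple_one[of "midpt one a" b] h
      by simp
  qed
  from multiplicative_doubling_dichotomy[OF G_ge G_mult G_dup]
  consider "\<forall>u\<ge>1. G u = 1" | "\<forall>u\<ge>1. G u = u" by blast
  then show ?thesis
  proof cases
    case 1
    have "\<psi> a = one" if a: "a \<in> hyperboloid" for a
    proof -
      have "fst (\<psi> a) = 1" using 1 G[OF a] hypD(1)[OF a] by simp
      moreover from this have "snd (\<psi> a) = 0" using hypD(3)[OF maps[OF a]] by simp
      ultimately show ?thesis by (simp add: prod_eq_iff)
    qed
    then show ?thesis by blast
  next
    case 2
    then show ?thesis using G_inner ip_ge by simp
  qed
qed

end

section \<open>Positive functionals that respect the triple product\<close>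

text \<open>Every positive definite matrix is \<open>S B S\<close> with \<open>S\<close> scalar and \<open>det B = 1\<close>; this writes it as a
  triple product, to which a homomorphism can be applied.\<close>
lemma fcone_decomp:
  assumes a: "a \<in> future_cone" and s: "s = sqrt (lorentz a)"
  shows "0 < s" "(1 / s) *\<^sub>R a \<in> hyperboloid" "triple (sqrt s *\<^sub>R one) ((1 / s) *\<^sub>R a) = a"
proof -
  show s0: "0 < s" using fconeD(2)[OF a] s by simp
  have "s\<^sup>2 = lorentz a" using fconeD(2)[OF a] s by simp
  then show "(1 / s) *\<^sub>R a \<in> hyperboloid" using s0 fconeD(1,2)[OF a]
    by (simp add: hyperboloid_def power_divide)
  show "triple (sqrt s *\<^sub>R one) ((1 / s) *\<^sub>R a) = a" using s0 by (simp add: triple_scale_one)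
qed

lemma scale_one_fcone [simp]: "t *\<^sub>R one \<in> future_cone \<longleftrightarrow> 0 < t"
  by (auto simp: future_cone_def)

text \<open>The map \<open>E\<close> sends \<open>r\<close> to the coordinates of a matrix with eigenvalues \<open>r\<close> and \<open>1 / r\<close> in a fixed
  eigenbasis, so \<open>E \<circ> p\<close> is a triple homomorphism of the hyperboloid with values in one geodesic.
  Such a map cannot preserve inner products, as two orthogonal directions show. By rigidity it is
  constant, \<open>p = 1\<close> on the hyperboloid, and \<open>p\<close> depends only on the scalar part.\<close>
proposition triple_functional_eq_powr:
  fixes p :: "real \<times> 'a::euclidean_space \<Rightarrow> real"
  assumes pos: "\<And>a. a \<in> future_cone \<Longrightarrow> 0 < p a"
    and hom: "\<And>a b. a \<in> future_cone \<Longrightarrow> b \<in> future_cone \<Longrightarrow> p (triple a b) = (p a)\<^sup>2 * p b"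
    and cont: "continuous_on future_cone p" and dim: "2 \<le> DIM('a)"
  obtains c where "\<And>a. a \<in> future_cone \<Longrightarrow> p a = lorentz a powr c"
proof -
  obtain e1 e2 :: 'a where e: "e1 \<bullet> e1 = 1" "e2 \<bullet> e2 = 1" "e1 \<bullet> e2 = 0"
    using ex_orthonormal_pair[OF dim] .
  define E :: "real \<Rightarrow> real \<times> 'a" where "E r = ((r + 1 / r) / 2, ((r - 1 / r) / 2) *\<^sub>R e1)" for r
  have E_hyp: "E r \<in> hyperboloid" if "0 < r" for r
  proof -
    have "lorentz (E r) = ((r + 1 / r) / 2)\<^sup>2 - ((r - 1 / r) / 2)\<^sup>2"
      by (simp add: E_def lor_eq e power2_eq_square)
    also have "\<dots> = 1" using that by (simp add: field_simps power2_eq_square)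
    finally show ?thesis using that by (simp add: hyperboloid_def E_def add_pos_pos)
  qed
  have E_triple: "triple (E r) (E s) = E (r\<^sup>2 * s)" if "0 < r" "0 < s" for r s
  proof -
    have 1: "2 * ((r + 1/r)/2 * ((s + 1/s)/2) + (r - 1/r)/2 * ((s - 1/s)/2)) = r * s + 1 / (r * s)"
      using that by (simp add: field_simps)
    have "2 * (E r \<bullet> E s) = r * s + 1 / (r * s)"
      unfolding 1[symmetric] by (simp add: E_def inner_prod_def e)
    then have "triple (E r) (E s) = (r * s + 1 / (r * s)) *\<^sub>R E r - bar (E s)"
      using hypD(2)[OF E_hyp[OF that(1)]] by (simp add: triple_def)
    also have "\<dots> = E (r\<^sup>2 * s)"
    proof (rule prod_eqI)
      show "fst ((r * s + 1 / (r * s)) *\<^sub>R E r - bar (E s)) = fst (E (r\<^sup>2 * s))"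
        using that by (simp add: E_def) (simp add: field_simps power2_eq_square)
      have "(r * s + 1 / (r * s)) * ((r - 1 / r) / 2) + (s - 1 / s) / 2 = (r\<^sup>2 * s - 1 / (r\<^sup>2 * s)) / 2"
        using that by (simp add: field_simps power2_eq_square)
      then show "snd ((r * s + 1 / (r * s)) *\<^sub>R E r - bar (E s)) = snd (E (r\<^sup>2 * s))"
        by (simp add: E_def flip: scaleR_add_left)
    qed
    finally show ?thesis .
  qed
  interpret E: hyp_triple_hom "\<lambda>a. E (p a)"
  proof
    show "continuous_on hyperboloid (\<lambda>a. E (p a))"
      unfolding E_def
      by (intro continuous_intros continuous_on_subset[OF cont])
        (auto dest!: hyp_fcone pos)
    show "E (p (triple a b)) = triple (E (p a)) (E (p b))" if "a \<in> hyperboloid" "b \<in> hyperboloid" for a b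
      using hyp_fcone[OF that(1)] hyp_fcone[OF that(2)] by (simp add: hom E_triple pos)
  qed (auto intro!: E_hyp pos simp: hyp_fcone dim)
  have p_hyp: "p a = 1" if a: "a \<in> hyperboloid" for a
    using E.rigidity
  proof
    assume "\<forall>a\<in>hyperboloid. E (p a) = one"
    then have "fst (E (p a)) = 1" using a by simp
    then have "p a * p a + 1 = 2 * p a" using pos[OF hyp_fcone[OF a]] by (simp add: E_def field_simps)
    then have "(p a - 1) * (p a - 1) = 0" by (simp add: algebra_simps)
    then show ?thesis by simp
  next
    assume iso: "\<forall>a\<in>hyperboloid. \<forall>b\<in>hyperboloid. E (p a) \<bullet> E (p b) = a \<bullet> b"
    \<comment> \<open>Two points of the hyperboloid in orthogonal directions.\<close>
    define a b where "a = (5/4 :: real, (3/4 :: real) *\<^sub>R e1)" and "b = (5/4 :: real, (3/4 :: real) *\<^sub>R e2)"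
    have ab: "a \<in> hyperboloid" "b \<in> hyperboloid" "a \<bullet> b = 25/16" "a \<bullet> one = 5/4" "b \<bullet> one = 5/4"
      by (simp_all add: a_def b_def hyperboloid_def lor_eq e inner_prod_def power2_eq_square)
    define x y where "x = (p a - 1 / p a) / 2" and "y = (p b - 1 / p b) / 2"
    have f: "fst (E (p a)) = 5/4" "fst (E (p b)) = 5/4"
      using iso[rule_format, OF ab(1) one_hyp] iso[rule_format, OF ab(2) one_hyp] ab(4,5)
      by (simp_all add: E.psi_one inner_prod_def[of "E _"])
    have s: "snd (E (p a)) = x *\<^sub>R e1" "snd (E (p b)) = y *\<^sub>R e1"
      by (simp_all add: E_def x_def y_def)
    have "x\<^sup>2 = 9/16" "y\<^sup>2 = 9/16"
      using hypD(3)[OF E.maps[OF ab(1)]] hypD(3)[OF E.maps[OF ab(2)]] unfolding f s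
      by (simp_all add: e power2_eq_square)
    moreover have "x * y = 0" using iso[rule_format, OF ab(1,2)] unfolding ab(3)
      by (auto simp: inner_prod_def[of "E _"] f s e)
    ultimately show ?thesis by auto
  qed
  have p_scale: "p a = p (sqrt (lorentz a) *\<^sub>R one)" if a: "a \<in> future_cone" for a
  proof -
    define s where "s = sqrt (lorentz a)"
    note d = fcone_decomp[OF a s_def]
    have "p a = (p (sqrt s *\<^sub>R one))\<^sup>2"
      using hom[of "sqrt s *\<^sub>R one" "(1 / s) *\<^sub>R a"] d p_hyp[OF d(2)] by (simp add: hyp_fcone)
    also have "\<dots> = p (s *\<^sub>R one)"
      using hom[of "sqrt s *\<^sub>R one" one] d(1) p_hyp[OF one_hyp]
      by (simp add: triple_scale_one)
    finally show ?thesis by (simp add: s_def)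
  qed
  have sm: "p ((s\<^sup>2 * t) *\<^sub>R one) = (p (s *\<^sub>R one))\<^sup>2 * p (t *\<^sub>R one)" if "0 < s" "0 < t" for s t
    using hom[of "s *\<^sub>R one" "t *\<^sub>R one"] that by (simp add: triple_scale_one)
  have sc: "continuous_on {0<..} (\<lambda>t. p (t *\<^sub>R one))"
    by (rule continuous_on_compose2[OF cont]) (auto intro!: continuous_intros)
  obtain c where c: "\<And>t. 0 < t \<Longrightarrow> p (t *\<^sub>R one) = t powr c"
    by (rule continuous_square_multiplicative_imp_powr[OF _ sm sc]) (auto intro: pos)
  have "p a = lorentz a powr (c / 2)" if "a \<in> future_cone" for a
    using p_scale[OF that] c[of "sqrt (lorentz a)"] fconeD(2)[OF that]
    by (simp add: powr_half_sqrt[symmetric] powr_powr)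
  then show ?thesis using that by blast
qed

section \<open>Triple homomorphisms of the cone\<close>

text \<open>For matrices the hypothesis reads \<open>A B\<^sup>2 A = B A\<^sup>2 B\<close>: the product \<open>BA\<close> is normal. For positive
  definite \<open>A\<close> and \<open>B\<close> this forces \<open>AB = BA\<close>, which for \<open>2 \<times> 2\<close> matrices means parallel
  vector parts. Comparing the vector parts of the two sides gives \<open>(H \<bullet> w) v = (H \<bullet> v) w\<close> with
  \<open>H = \<alpha> w + \<beta> v\<close>. Either this is a nontrivial linear relation, or \<open>H\<close> is orthogonal to itself.\<close>
lemma snd_parallel_if_commute:
  assumes a: "a \<in> future_cone" and b: "b \<in> future_cone"
    and comm: "triple a (triple b one) = triple b (triple a one)" and nz: "snd b \<noteq> 0"
  obtains r where "snd a = r *\<^sub>R snd b"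
proof -
  obtain \<alpha> v \<beta> w where ab [simp]: "a = (\<alpha>, v)" "b = (\<beta>, w)" by (metis surj_pair)
  have pos: "0 < \<alpha>" "0 < \<beta>" and w0: "w \<noteq> 0" using fconeD(1)[OF a] fconeD(1)[OF b] nz by auto
  define x y z where "x = v \<bullet> v" and "y = w \<bullet> w" and "z = v \<bullet> w"
  define s where "s = \<alpha> * y + \<beta> * z"
  define t where "t = \<beta> * x + \<alpha> * z"
  \<comment> \<open>Testing against an arbitrary \<open>u\<close> turns the vector identity into a polynomial one.\<close>
  have "u \<bullet> snd (triple a (triple b one)) - u \<bullet> snd (triple b (triple a one))
      = u \<bullet> ((4 * s) *\<^sub>R v) - u \<bullet> ((4 * t) *\<^sub>R w)" for u
    by (simp add: triple_def lor_eq inner_prod_def one_def bar_def inner_commute[of w v]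
        inner_add_right inner_diff_right power2_eq_square algebra_simps s_def t_def
        flip: x_def y_def z_def)
  then have "u \<bullet> ((4 * s) *\<^sub>R v) = u \<bullet> ((4 * t) *\<^sub>R w)" for u using comm by (metis diff_self eq_iff_diff_eq_0)
  then have e: "(4 * s) *\<^sub>R v = (4 * t) *\<^sub>R w" using vector_eq_ldot by blast
  show ?thesis
  proof (cases "s = 0")
    case False
    have "v = (1 / (4 * s)) *\<^sub>R ((4 * s) *\<^sub>R v)" using False by simp
    then show ?thesis using that[of "(1 / (4 * s)) * (4 * t)"] unfolding e by simp
  next
    case True
    then have "t = 0" using e w0 by simp
    have "(\<alpha> *\<^sub>R w + \<beta> *\<^sub>R v) \<bullet> (\<alpha> *\<^sub>R w + \<beta> *\<^sub>R v) = \<alpha> * s + \<beta> * t"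
      by (simp add: s_def t_def x_def y_def z_def inner_add_left inner_add_right inner_commute[of w v]
          algebra_simps)
    then have "\<alpha> *\<^sub>R w + \<beta> *\<^sub>R v = 0" using True \<open>t = 0\<close> by simp
    then have "(1 / \<beta>) *\<^sub>R (\<beta> *\<^sub>R v) = (1 / \<beta>) *\<^sub>R (- \<alpha> *\<^sub>R w)"
      by (simp add: add_eq_0_iff)
    then show ?thesis using that[of "- \<alpha> / \<beta>"] pos by simp
  qed
qed

locale cone_triple_hom =
  fixes \<Phi> :: "real \<times> 'a::euclidean_space \<Rightarrow> real \<times> 'a"
  assumes maps: "a \<in> future_cone \<Longrightarrow> \<Phi> a \<in> future_cone"
    and hom: "a \<in> future_cone \<Longrightarrow> b \<in> future_cone \<Longrightarrow> \<Phi> (triple a b) = triple (\<Phi> a) (\<Phi> b)"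
    and cont: "continuous_on future_cone \<Phi>"
    and dim: "2 \<le> DIM('a)"
begin

text \<open>The functional \<open>det \<circ> \<Phi>\<close> respects the triple product.\<close>
lemma lor_image: obtains c where "\<And>a. a \<in> future_cone \<Longrightarrow> lorentz (\<Phi> a) = lorentz a powr c"
proof -
  have "continuous_on future_cone (\<lambda>a. lorentz (\<Phi> a))"
    unfolding lor_eq by (intro continuous_intros cont)
  moreover have "0 < lorentz (\<Phi> a)" if "a \<in> future_cone" for a
    using that by (simp add: fconeD maps)
  moreover have "lorentz (\<Phi> (triple a b)) = (lorentz (\<Phi> a))\<^sup>2 * lorentz (\<Phi> b)" if "a \<in> future_cone" "b \<in> future_cone" for a b
    using that by (simp add: hom lor_triple)
  ultimately show ?thesis
    using triple_functional_eq_powr[of "\<lambda>a. lorentz (\<Phi> a)"] dim that by blast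
qed

lemma restricts_to_hyperboloid: "hyp_triple_hom \<Phi>"
proof
  obtain c where c: "\<And>a. a \<in> future_cone \<Longrightarrow> lorentz (\<Phi> a) = lorentz a powr c" using lor_image by blast
  show "\<Phi> a \<in> hyperboloid" if "a \<in> hyperboloid" for a
    using c[OF hyp_fcone[OF that]] fconeD(1)[OF maps[OF hyp_fcone[OF that]]] that
    by (simp add: hyperboloid_def)
  show "continuous_on hyperboloid \<Phi>"
    using cont by (rule continuous_on_subset) (auto simp: hyp_fcone)
qed (auto simp: hom hyp_fcone dim)

lemma image_one: "\<Phi> one = one"
  by (rule hyp_triple_hom.psi_one[OF restricts_to_hyperboloid])

lemma image_decomp:
  assumes a: "a \<in> future_cone" and s: "s = sqrt (lorentz a)"
  shows "\<Phi> a = triple (\<Phi> (sqrt s *\<^sub>R one)) (\<Phi> ((1 / s) *\<^sub>R a))"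
  using hom[of "sqrt s *\<^sub>R one" "(1 / s) *\<^sub>R a"] fcone_decomp[OF a s] by (simp add: hyp_fcone)

text \<open>If \<open>AB = BA\<close>, then \<open>A B\<^sup>2 A = B A\<^sup>2 B\<close>, and this relation, unlike commutativity itself, is made of triple
  products and so passes to the images.\<close>
lemma scalars_commute:
  assumes t: "0 < t" and a: "a \<in> future_cone"
  shows "triple (\<Phi> (t *\<^sub>R one)) (triple (\<Phi> a) one) = triple (\<Phi> a) (triple (\<Phi> (t *\<^sub>R one)) one)"
proof -
  have o: "one \<in> future_cone" "t *\<^sub>R one \<in> future_cone" using t by (auto simp: hyp_fcone)
  have "triple (t *\<^sub>R one) (triple a one) = triple a (triple (t *\<^sub>R one) one)"
    by (simp add: triple_scale_one triple_scaleR_right)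
  then have "\<Phi> (triple (t *\<^sub>R one) (triple a one)) = \<Phi> (triple a (triple (t *\<^sub>R one) one))"
    by (rule arg_cong)
  then show ?thesis using a o by (simp add: hom triple_fcone image_one)
qed

lemma scalars_parallel:
  assumes "0 < t" "a \<in> future_cone" "snd (\<Phi> a) \<noteq> 0"
  obtains r where "snd (\<Phi> (t *\<^sub>R one)) = r *\<^sub>R snd (\<Phi> a)"
proof (rule snd_parallel_if_commute[of "\<Phi> (t *\<^sub>R one)" "\<Phi> a"])
qed (use assms that in \<open>auto simp: maps scalars_commute\<close>)

text \<open>All values are images of scalar matrices, so they commute by \<open>scalars_commute\<close> and are diagonal in a common basis,
  given by the direction \<open>n\<close>. The eigenvalues \<open>fst \<plusminus> y\<close> satisfy the functional
  equation of a power function.\<close>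
lemma degenerate_form:
  assumes triv: "\<And>a. a \<in> hyperboloid \<Longrightarrow> \<Phi> a = one"
  obtains n c1 c2 where "norm n = 1"
    "\<And>a. a \<in> future_cone \<Longrightarrow> \<Phi> a = ((lorentz a powr c1 + lorentz a powr c2) / 2, ((lorentz a powr c1 - lorentz a powr c2) / 2) *\<^sub>R n)"
proof -
  define F where "F t = \<Phi> (t *\<^sub>R one)" for t
  have F_fcone: "F t \<in> future_cone" if "0 < t" for t using that by (simp add: F_def maps)
  have F_triple: "F (s\<^sup>2 * t) = triple (F s) (F t)" if "0 < s" "0 < t" for s t
    using hom[of "s *\<^sub>R one" "t *\<^sub>R one"] that by (simp add: F_def triple_scale_one)
  have \<Phi>_F: "\<Phi> a = F (sqrt (lorentz a))" if a: "a \<in> future_cone" for a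
  proof -
    define s where "s = sqrt (lorentz a)"
    note d = fcone_decomp[OF a s_def]
    have "\<Phi> a = triple (F (sqrt s)) (F 1)"
      using image_decomp[OF a s_def] triv[OF d(2)] by (simp add: F_def image_one)
    also have "\<dots> = F s" using F_triple[of "sqrt s" 1] d(1) by simp
    finally show ?thesis by (simp add: s_def)
  qed
  obtain n where n: "norm n = 1" "\<And>t. 0 < t \<Longrightarrow> \<exists>r. snd (F t) = r *\<^sub>R n"
  proof (cases "\<exists>t>0. snd (F t) \<noteq> 0")
    case False
    obtain n :: 'a where "norm n = 1" using vector_choose_size[of 1] by auto
    moreover have "\<exists>r. snd (F t) = r *\<^sub>R n" if "0 < t" for t
      using False that by (intro exI[of _ 0]) auto
    ultimately show ?thesis using that by blast
  next
    case True
    then obtain t0 where t0: "0 < t0" "snd (F t0) \<noteq> 0" by blast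
    show ?thesis
    proof (rule that)
      show "norm (sgn (snd (F t0))) = 1" using t0 by (simp add: norm_sgn)
      fix t :: real assume "0 < t"
      then obtain r where "snd (F t) = r *\<^sub>R snd (F t0)"
        using scalars_parallel[of t "t0 *\<^sub>R one"] t0 unfolding F_def by auto
      then show "\<exists>r. snd (F t) = r *\<^sub>R sgn (snd (F t0))"
        using t0 by (intro exI[of _ "r * norm (snd (F t0))"]) (simp add: sgn_div_norm)
    qed
  qed
  have nn: "n \<bullet> n = 1" using n(1) by (simp add: norm_eq_1)
  define y where "y t = snd (F t) \<bullet> n" for t
  have y: "snd (F t) = y t *\<^sub>R n" if t: "0 < t" for t
    using n(2)[OF t] nn by (auto simp: y_def)
  have pos: "0 < fst (F t) + y t" "0 < fst (F t) - y t" if t: "0 < t" for t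
    using fconeD(3)[OF F_fcone[OF t]] n(1) y[OF t] by auto
  have Ft: "fst (F (s\<^sup>2 * t)) = 2 * (fst (F s) * fst (F t) + y s * y t) * fst (F s) - ((fst (F s))\<^sup>2 - (y s)\<^sup>2) * fst (F t)"
    "y (s\<^sup>2 * t) = 2 * (fst (F s) * fst (F t) + y s * y t) * y s + ((fst (F s))\<^sup>2 - (y s)\<^sup>2) * y t"
    if "0 < s" "0 < t" for s t
    unfolding y_def[of "s\<^sup>2 * t"] F_triple[OF that]
    using y[OF that(1)] y[OF that(2)] nn
    by (simp_all add: triple_def lor_eq inner_prod_def power2_eq_square inner_add_left inner_diff_left)
  have F_cont: "continuous_on {0<..} F"
    unfolding F_def by (rule continuous_on_compose2[OF cont]) (auto intro!: continuous_intros)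
  have cp: "continuous_on {0<..} (\<lambda>t. fst (F t) + y t)" "continuous_on {0<..} (\<lambda>t. fst (F t) - y t)"
    unfolding y_def by (intro continuous_intros F_cont)+
  have mp: "fst (F (s\<^sup>2 * t)) + y (s\<^sup>2 * t) = (fst (F s) + y s)\<^sup>2 * (fst (F t) + y t)"
    "fst (F (s\<^sup>2 * t)) - y (s\<^sup>2 * t) = (fst (F s) - y s)\<^sup>2 * (fst (F t) - y t)"
    if "0 < s" "0 < t" for s t
    unfolding Ft[OF that] by (simp_all add: power2_eq_square algebra_simps)
  obtain c1 where c1: "\<And>t. 0 < t \<Longrightarrow> fst (F t) + y t = t powr c1"
    using continuous_square_multiplicative_imp_powr[OF pos(1) mp(1) cp(1)] by blast
  obtain c2 where c2: "\<And>t. 0 < t \<Longrightarrow> fst (F t) - y t = t powr c2"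
    using continuous_square_multiplicative_imp_powr[OF pos(2) mp(2) cp(2)] by blast
  have F_eq: "F t = ((t powr c1 + t powr c2) / 2, ((t powr c1 - t powr c2) / 2) *\<^sub>R n)" if "0 < t" for t
    using y[OF that] by (simp add: prod_eq_iff flip: c1[OF that] c2[OF that])
  show ?thesis
  proof (rule that[OF n(1)])
    fix a :: "real \<times> 'a" assume a: "a \<in> future_cone"
    have "sqrt (lorentz a) powr c = lorentz a powr (c / 2)" for c
      using fconeD(2)[OF a] by (simp add: powr_half_sqrt[symmetric] powr_powr)
    then show "\<Phi> a = ((lorentz a powr (c1 / 2) + lorentz a powr (c2 / 2)) / 2,
        ((lorentz a powr (c1 / 2) - lorentz a powr (c2 / 2)) / 2) *\<^sub>R n)"
      using \<Phi>_F[OF a] F_eq[of "sqrt (lorentz a)"] fconeD(2)[OF a] by simp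
  qed
qed

text \<open>Since \<open>\<Phi>\<close> preserves inner products with \<open>one\<close>, it fixes the time coordinate on the hyperboloid; there it acts on vector parts by a
  map \<open>g\<close> that preserves inner products, hence an orthogonal transformation. The image of a scalar
  matrix has a vector part parallel to two orthogonal vectors, so it is again scalar, and its value
  follows from its determinant.\<close>
lemma isometric_form:
  assumes iso: "\<And>a b. a \<in> hyperboloid \<Longrightarrow> b \<in> hyperboloid \<Longrightarrow> \<Phi> a \<bullet> \<Phi> b = a \<bullet> b"
  obtains c g where "orthogonal_transformation g"
    "\<And>a. a \<in> future_cone \<Longrightarrow> \<Phi> a = (lorentz a powr c) *\<^sub>R (fst a, g (snd a))"
proof -
  define lift :: "'a \<Rightarrow> real \<times> 'a" where "lift v = (sqrt (1 + v \<bullet> v), v)" for v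
  have lift: "lift v \<in> hyperboloid" for v
    using inner_ge_zero[of v] by (simp add: lift_def hyperboloid_def lor_eq add_pos_nonneg)
  have lift_snd: "lift (snd a) = a" if "a \<in> hyperboloid" for a
    using hypD[OF that] by (simp add: lift_def prod_eq_iff)
  have fst_\<Phi>: "fst (\<Phi> a) = fst a" if "a \<in> hyperboloid" for a
    using iso[OF that one_hyp] by (simp add: image_one inner_prod_def)
  define g where "g v = snd (\<Phi> (lift v))" for v
  have g_inner: "g v \<bullet> g w = v \<bullet> w" for v w
    using iso[OF lift[of v] lift[of w]] fst_\<Phi>[OF lift[of v]] fst_\<Phi>[OF lift[of w]]
    by (simp add: inner_prod_def g_def lift_def)
  have g: "orthogonal_transformation g"
    unfolding orthogonal_transformation_isometry
  proof safe
    show "g 0 = 0" using g_inner[of 0 0] by simp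
    show "dist (g v) (g w) = dist v w" for v w
      by (simp add: dist_norm norm_eq_sqrt_inner inner_diff_left inner_diff_right g_inner)
  qed
  have \<Phi>_hyp: "\<Phi> a = (fst a, g (snd a))" if "a \<in> hyperboloid" for a
    unfolding g_def lift_snd[OF that] using fst_\<Phi>[OF that] by (simp add: prod_eq_iff)
  obtain c where c: "\<And>a. a \<in> future_cone \<Longrightarrow> lorentz (\<Phi> a) = lorentz a powr c" using lor_image by blast
  obtain e1 e2 :: 'a where e: "e1 \<bullet> e1 = 1" "e2 \<bullet> e2 = 1" "e1 \<bullet> e2 = 0"
    using ex_orthonormal_pair[OF dim] .
  have scal: "\<Phi> (t *\<^sub>R one) = (t powr c) *\<^sub>R one" if t: "0 < t" for t
  proof -
    let ?w = "snd (\<Phi> (t *\<^sub>R one))"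
    have "g e1 \<noteq> 0" "g e2 \<noteq> 0" using g_inner[of e1 e1] g_inner[of e2 e2] e by auto
    then obtain r1 r2 where r: "?w = r1 *\<^sub>R g e1" "?w = r2 *\<^sub>R g e2"
      using scalars_parallel[OF t hyp_fcone[OF lift[of e1]]]
        scalars_parallel[OF t hyp_fcone[OF lift[of e2]]] unfolding g_def by metis
    have "?w \<bullet> ?w = (r1 *\<^sub>R g e1) \<bullet> (r2 *\<^sub>R g e2)" by (simp only: r(1)[symmetric] r(2)[symmetric])
    then have w: "?w = 0" by (simp add: g_inner e)
    have p: "0 < fst (\<Phi> (t *\<^sub>R one))" using t by (simp add: fconeD maps)
    have "(fst (\<Phi> (t *\<^sub>R one)))\<^sup>2 = (t\<^sup>2) powr c"
      using c[of "t *\<^sub>R one"] t w by (simp add: lor_eq[of "\<Phi> (t *\<^sub>R one)"])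
    also have "\<dots> = (t powr c)\<^sup>2" using t by (simp add: power2_eq_square powr_mult)
    finally have "fst (\<Phi> (t *\<^sub>R one)) = t powr c"
      by (rule power2_eq_imp_eq) (use p in auto)
    then show ?thesis using w by (simp add: prod_eq_iff)
  qed
  show ?thesis
  proof (rule that[OF g])
    fix a :: "real \<times> 'a" assume a: "a \<in> future_cone"
    define s where "s = sqrt (lorentz a)"
    note d = fcone_decomp[OF a s_def]
    have gl: "g ((1 / s) *\<^sub>R snd a) = (1 / s) *\<^sub>R g (snd a)"
      using g by (simp add: orthogonal_transformation_linear linear_cmul)
    have "\<Phi> a = ((sqrt s powr c)\<^sup>2) *\<^sub>R \<Phi> ((1 / s) *\<^sub>R a)"
      using image_decomp[OF a s_def] scal[of "sqrt s"] d(1) by (simp add: triple_scale_one)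
    also have "(sqrt s powr c)\<^sup>2 = s powr c" using d(1) by (simp add: power2_eq_square flip: powr_mult)
    also have "\<Phi> ((1 / s) *\<^sub>R a) = (1 / s) *\<^sub>R (fst a, g (snd a))"
      using \<Phi>_hyp[OF d(2)] gl by (simp add: prod_eq_iff)
    also have "(s powr c) *\<^sub>R \<dots> = (s powr (c - 1)) *\<^sub>R (fst a, g (snd a))"
      using d(1) by (simp add: powr_diff)
    also have "s powr (c - 1) = lorentz a powr ((c - 1) / 2)"
      using fconeD(2)[OF a] by (simp add: s_def powr_half_sqrt[symmetric] powr_powr)
    finally show "\<Phi> a = (lorentz a powr ((c - 1) / 2)) *\<^sub>R (fst a, g (snd a))" .
  qed
qed

end

section \<open>Hermitian matrices as points of Minkowski space\<close>

definition herm :: "real \<times> (real ^ 3) \<Rightarrow> complex ^ 2 ^ 2" where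
  "herm a = vector
     [vector [Complex (fst a + snd a $ 3) 0, Complex (snd a $ 1) (- snd a $ 2)],
      vector [Complex (snd a $ 1) (snd a $ 2), Complex (fst a - snd a $ 3) 0]]"

definition unherm :: "complex ^ 2 ^ 2 \<Rightarrow> real \<times> (real ^ 3)" where
  "unherm A = ((Re (A $ 1 $ 1) + Re (A $ 2 $ 2)) / 2,
     vector [Re (A $ 2 $ 1), Im (A $ 2 $ 1), (Re (A $ 1 $ 1) - Re (A $ 2 $ 2)) / 2])"

lemma herm_nth [simp]:
  "herm a $ 1 $ 1 = Complex (fst a + snd a $ 3) 0" "herm a $ 1 $ 2 = Complex (snd a $ 1) (- snd a $ 2)"
  "herm a $ 2 $ 1 = Complex (snd a $ 1) (snd a $ 2)" "herm a $ 2 $ 2 = Complex (fst a - snd a $ 3) 0"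
  by (simp_all add: herm_def)

lemma inner_3: "(v :: real ^ 3) \<bullet> w = v $ 1 * w $ 1 + v $ 2 * w $ 2 + v $ 3 * w $ 3"
  by (simp add: inner_vec_def sum_3)

lemma lor_3: "lorentz (a :: real \<times> (real ^ 3))
    = (fst a)\<^sup>2 - ((snd a $ 1)\<^sup>2 + (snd a $ 2)\<^sup>2 + (snd a $ 3)\<^sup>2)"
  by (simp add: lor_eq inner_3 power2_eq_square)

lemma unherm_herm [simp]: "unherm (herm a) = a"
  by (simp add: unherm_def prod_eq_iff vec_eq_iff forall_3)

lemma herm_scaleR: "herm (r *\<^sub>R a) = r *\<^sub>R herm a"
  by (simp add: vec_eq_iff forall_2 complex_eq_iff algebra_simps)

lemma herm_one: "herm one = mat 1"
  by (simp add: vec_eq_iff forall_2 complex_eq_iff mat_def)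

lemma conj_transpose_herm [simp]: "conj_transpose (herm a) = herm a"
  by (simp add: vec_eq_iff forall_2 conj_transpose_def complex_eq_iff)

lemma det_herm: "det (herm a) = of_real (lorentz a)"
  by (simp add: det_2 complex_eq_iff lor_3 power2_eq_square algebra_simps)

lemma herm_bar: "herm a ** herm (bar a) = lorentz a *\<^sub>R mat 1"
  by (simp add: vec_eq_iff forall_2 matrix_matrix_mult_def sum_2 complex_eq_iff mat_def
      lor_3 power2_eq_square algebra_simps)

lemma herm_triple: "herm a ** herm b ** herm a = herm (triple a b)"
  by (simp add: vec_eq_iff forall_2 matrix_matrix_mult_def sum_2 complex_eq_iff triple_def
      lor_3 inner_prod_def inner_3 power2_eq_square algebra_simps)

lemma herm_unherm: assumes "A \<in> P2" shows "herm (unherm A) = A"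
proof -
  have "conj_transpose A = A" using assms by (simp add: P2_def positive_definite_def)
  then have "cnj (A $ j $ i) = A $ i $ j" for i j
    by (simp add: conj_transpose_def vec_eq_iff)
  from this[of 1 1] this[of 1 2] this[of 2 2] show ?thesis
    by (simp add: vec_eq_iff forall_2 complex_eq_iff unherm_def field_simps)
qed

text \<open>For a cone point, completing the square gives
  \<open>(t + z) x\<^sup>* A x = \<bar>(t + z) x\<^sub>1 + A\<^sub>1\<^sub>2 x\<^sub>2\<bar>\<^sup>2 + det A \<bar>x\<^sub>2\<bar>\<^sup>2\<close>. Conversely, the diagonal entries \<open>t + z\<close> and
  \<open>t - z\<close> of a positive definite matrix are positive, and so is its determinant.\<close>
lemma herm_P2_iff: "herm a \<in> P2 \<longleftrightarrow> a \<in> future_cone"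
proof
  assume h: "herm a \<in> P2"
  have q: "Re (\<Sum>i\<in>UNIV. cnj (x $ i) * (herm a *v x) $ i) > 0" if "x \<noteq> 0" for x
    using h that by (simp add: P2_def positive_definite_def)
  have "0 < fst a + snd a $ 3" using q[of "vector [1, 0]"]
    by (simp add: vec_eq_iff forall_2 sum_2 matrix_vector_mult_def)
  moreover have "0 < fst a - snd a $ 3" using q[of "vector [0, 1]"]
    by (simp add: vec_eq_iff forall_2 sum_2 matrix_vector_mult_def)
  moreover have "0 < lorentz a" using det_P2(2)[OF h] by (simp add: det_herm)
  ultimately show "a \<in> future_cone" by (simp add: future_cone_def)
next
  assume a: "a \<in> future_cone"
  let ?t = "fst a" and ?x = "snd a $ 1" and ?y = "snd a $ 2" and ?z = "snd a $ 3"
  have "\<bar>?z\<bar> \<le> norm (snd a)" by (rule component_le_norm_cart)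
  then have p: "0 < ?t + ?z" using fconeD(3)[OF a] by linarith
  have "0 < Re (\<Sum>i\<in>UNIV. cnj (x $ i) * (herm a *v x) $ i)" (is "0 < ?Q") if "x \<noteq> 0" for x
  proof -
    define p1 q1 p2 q2 where "p1 = Re (x $ 1)" and "q1 = Im (x $ 1)" and "p2 = Re (x $ 2)" and "q2 = Im (x $ 2)"
    have Q: "(?t + ?z) * ?Q = ((?t + ?z) * p1 + ?x * p2 + ?y * q2)\<^sup>2
        + ((?t + ?z) * q1 + ?x * q2 - ?y * p2)\<^sup>2 + lorentz a * (p2\<^sup>2 + q2\<^sup>2)"
      by (simp add: sum_2 matrix_vector_mult_def lor_3 power2_eq_square algebra_simps
          p1_def q1_def p2_def q2_def)
    have "0 < (?t + ?z) * ?Q"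
    proof (cases "x $ 2 = 0")
      case True
      then have "x $ 1 \<noteq> 0" using that by (auto simp: vec_eq_iff forall_2)
      then have "p1 \<noteq> 0 \<or> q1 \<noteq> 0" by (auto simp: p1_def q1_def complex_eq_iff)
      moreover have "p2 = 0" "q2 = 0" using True by (auto simp: p2_def q2_def)
      ultimately show ?thesis unfolding Q using p by (auto simp: add_pos_nonneg add_nonneg_pos)
    next
      case False
      then have "p2 \<noteq> 0 \<or> q2 \<noteq> 0" by (auto simp: p2_def q2_def complex_eq_iff)
      then have "0 < p2\<^sup>2 + q2\<^sup>2" by (simp add: sum_power2_gt_zero_iff)
      then have "0 < lorentz a * (p2\<^sup>2 + q2\<^sup>2)" using fconeD(2)[OF a] by simp
      then show ?thesis unfolding Q by (intro add_nonneg_pos add_nonneg_nonneg zero_le_power2)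
    qed
    then show ?thesis using p by (simp add: zero_less_mult_iff)
  qed
  then show "herm a \<in> P2" by (simp add: P2_def positive_definite_def)
qed

lemma continuous_on_herm: "continuous_on S herm"
proof -
  have "continuous_on S (\<lambda>a. herm a $ i $ j)" for i j
    using exhaust_2[of i] exhaust_2[of j]
    by (elim disjE; simp add: Complex_eq; intro continuous_intros)
  then have "continuous_on S (\<lambda>a. \<chi> i j. herm a $ i $ j)" by (intro continuous_on_vec_lambda)
  then show ?thesis by simp
qed

lemma continuous_on_unherm: "continuous_on S unherm"
proof -
  have "continuous_on S (\<lambda>A. snd (unherm A) $ i)" for i
    using exhaust_3[of i] by (elim disjE; simp add: unherm_def; intro continuous_intros; simp)
  then have "continuous_on S (\<lambda>A. \<chi> i. snd (unherm A) $ i)" by (intro continuous_on_vec_lambda)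
  then have "continuous_on S (\<lambda>A. (fst (unherm A), snd (unherm A)))"
    by (intro continuous_on_Pair) (auto simp: unherm_def intro!: continuous_intros)
  then show ?thesis by simp
qed

lemma matrix_inv_unique:
  fixes A :: "'a::semiring_1 ^ 'n ^ 'm"
  assumes "A ** B = mat 1" "B ** A = mat 1"
  shows "matrix_inv A = B"
proof -
  have "A ** matrix_inv A = mat 1"
    unfolding matrix_inv_def by (rule someI2[of _ B]) (use assms in auto)
  then have "B ** (A ** matrix_inv A) = B" by simp
  then show ?thesis using assms by (simp add: matrix_mul_assoc)
qed

lemma matrix_inv_herm: assumes "lorentz a \<noteq> 0" shows "matrix_inv (herm a) = (1 / lorentz a) *\<^sub>R herm (bar a)"
proof -
  have "herm a ** ((1 / lorentz a) *\<^sub>R herm (bar a)) = mat 1"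
    using assms by (simp add: matrix_scalar_ac herm_bar flip: scalar_matrix_assoc)
  moreover from this have "((1 / lorentz a) *\<^sub>R herm (bar a)) ** herm a = mat 1"
    by (rule matrix_left_right_inverse[THEN iffD1])
  ultimately show ?thesis by (rule matrix_inv_unique)
qed

section \<open>Orthogonal transformations as unitary conjugations\<close>

lemma conj_transpose_mult: "conj_transpose (A ** B) = conj_transpose B ** conj_transpose A"
  by (simp add: conj_transpose_def matrix_matrix_mult_def vec_eq_iff mult.commute)

lemma unitary_mat_1: "unitary (mat 1)"
proof -
  have "conj_transpose (mat 1 :: complex ^ 'n ^ 'n) = mat 1"
    by (simp add: conj_transpose_def mat_def vec_eq_iff)
  then show ?thesis by (simp add: unitary_def)
qed

lemma unitary_mult: assumes "unitary U" "unitary V" shows "unitary (U ** V)"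
proof -
  have "conj_transpose V ** (conj_transpose U ** U) ** V = mat 1"
    "U ** (V ** conj_transpose V) ** conj_transpose U = mat 1"
    using assms by (simp_all add: unitary_def)
  then show ?thesis by (simp add: unitary_def conj_transpose_mult matrix_mul_assoc)
qed

lemma unitary_herm_unit: assumes "norm n = 1" shows "unitary (herm (0, n))"
proof -
  have "triple (0, n) one = one"
    using assms by (simp add: triple_one_right lor_eq norm_eq_1 zero_prod_def)
  then have "herm (0, n) ** herm (0, n) = mat 1"
    using herm_triple[of "(0, n)" one] by (simp add: herm_one)
  then show ?thesis by (simp add: unitary_def)
qed

text \<open>Conjugation by \<open>n \<cdot> \<sigma>\<close> rotates the vector part by the angle \<open>\<pi>\<close> about \<open>n\<close>; this is the negative of the
  reflection in the plane orthogonal to \<open>n\<close>.\<close>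
lemma herm_half_turn:
  assumes "norm n = 1"
  shows "herm (0, n) ** herm (t, v) ** herm (0, n) = herm (t, (2 * (n \<bullet> v)) *\<^sub>R n - v)"
proof -
  have "triple (0 :: real, n) (t, v) = (t, (2 * (n \<bullet> v)) *\<^sub>R n - v)"
    using assms by (simp add: triple_def lor_eq norm_eq_1 bar_def)
  then show ?thesis by (simp add: herm_triple)
qed

text \<open>The sign cannot be avoided: conjugations induce only rotations, so an orthogonal transformation of
  determinant \<open>-1\<close> needs \<open>s = -1\<close>.\<close>
definition unitarily_implemented :: "(real ^ 3 \<Rightarrow> real ^ 3) \<Rightarrow> bool" where
  "unitarily_implemented g \<longleftrightarrow> (\<exists>U s. unitary U \<and> (s = 1 \<or> s = - 1) \<and>
     (\<forall>t v. U ** herm (t, v) ** conj_transpose U = herm (t, s *\<^sub>R g v)))"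

text \<open>A reflection multiplies the unitary matrix by \<open>n \<cdot> \<sigma>\<close> and changes the sign.\<close>
lemma unitarily_implemented_reflection_comp:
  assumes n: "norm n = 1" and h: "unitarily_implemented h"
    and g: "\<And>v. g v = h v - (2 * (n \<bullet> h v)) *\<^sub>R n"
  shows "unitarily_implemented g"
proof -
  obtain U s where U: "unitary U" "s = 1 \<or> s = - 1"
    "\<And>t v. U ** herm (t, v) ** conj_transpose U = herm (t, s *\<^sub>R h v)"
    using h unfolding unitarily_implemented_def by blast
  have "(herm (0, n) ** U) ** herm (t, v) ** conj_transpose (herm (0, n) ** U) = herm (t, (- s) *\<^sub>R g v)"
    for t v
  proof -
    have "(herm (0, n) ** U) ** herm (t, v) ** conj_transpose (herm (0, n) ** U)
        = herm (0, n) ** (U ** herm (t, v) ** conj_transpose U) ** herm (0, n)"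
      by (simp add: conj_transpose_mult matrix_mul_assoc)
    also have "\<dots> = herm (t, (2 * (n \<bullet> (s *\<^sub>R h v))) *\<^sub>R n - s *\<^sub>R h v)"
      unfolding U(3) by (rule herm_half_turn[OF n])
    also have "(2 * (n \<bullet> (s *\<^sub>R h v))) *\<^sub>R n - s *\<^sub>R h v = (- s) *\<^sub>R g v"
      by (simp add: g algebra_simps)
    finally show ?thesis .
  qed
  then show ?thesis
    unfolding unitarily_implemented_def using U(1,2) unitary_mult[OF unitary_herm_unit[OF n] U(1)]
    by (intro exI[of _ "herm (0, n) ** U"] exI[of _ "- s"]) auto
qed

text \<open>If \<open>g\<close> moves \<open>e\<close>, the reflection that swaps \<open>g e\<close> and \<open>e\<close>, composed with \<open>g\<close>, fixes \<open>e\<close>.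
  Fixed vectors \<open>x\<close> of \<open>g\<close> that are orthogonal to \<open>e\<close> are also orthogonal to \<open>g e\<close>, hence lie in the
  mirror and remain fixed.\<close>
lemma unitarily_implemented_reduce:
  assumes g: "orthogonal_transformation g"
  obtains h where "orthogonal_transformation h" "h e = e"
    "\<And>x. g x = x \<Longrightarrow> x \<bullet> e = 0 \<Longrightarrow> h x = x"
    "unitarily_implemented h \<Longrightarrow> unitarily_implemented g"
proof (cases "g e = e")
  case True then show ?thesis using that[of g] g by blast
next
  case False
  define n where "n = sgn (g e - e)"
  have n: "norm n = 1" "n \<bullet> n = 1" using False by (simp_all add: n_def norm_sgn flip: norm_eq_1)
  have gi: "g v \<bullet> g w = v \<bullet> w" for v w using g by (simp add: orthogonal_transformation_def)
  define R where "R v = v - (2 * (n \<bullet> v)) *\<^sub>R n" for v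
  have RR: "R (R v) = v" for v by (simp add: R_def inner_diff_right n algebra_simps)
  have Ri: "R v \<bullet> R w = v \<bullet> w" for v w
    by (simp add: R_def inner_diff_right inner_diff_left n algebra_simps inner_commute)
  have lR: "linear R"
    unfolding R_def by (intro linearI) (simp_all add: inner_add_right algebra_simps)
  have oR: "orthogonal_transformation R" using lR Ri by (simp add: orthogonal_transformation_def)
  define h where "h = R \<circ> g"
  show ?thesis
  proof (rule that[of h])
    show "orthogonal_transformation h" unfolding h_def
      using oR g by (rule orthogonal_transformation_compose)
    have nd: "norm (g e - e) *\<^sub>R n = g e - e" by (simp add: n_def sgn_div_norm False)
    have "(2 * (n \<bullet> g e)) *\<^sub>R n = g e - e"
    proof -
      have "(g e - e) \<bullet> (g e - e) = 2 * ((g e - e) \<bullet> g e)"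
        using gi[of e e] by (simp add: inner_diff_left inner_diff_right inner_commute)
      then have "(norm (g e - e))\<^sup>2 = 2 * (norm (g e - e) * (n \<bullet> g e))"
        unfolding power2_norm_eq_inner by (subst (asm) (3) nd[symmetric]) simp
      then have "norm (g e - e) = 2 * (n \<bullet> g e)" using False by (simp add: power2_eq_square)
      then show ?thesis using nd by simp
    qed
    then show "h e = e" by (simp add: h_def R_def)
    show "h x = x" if "g x = x" "x \<bullet> e = 0" for x
    proof -
      have "g e \<bullet> x = 0" using gi[of e x] that by (simp add: inner_commute)
      then have "n \<bullet> x = 0" using that
        by (simp add: n_def sgn_div_norm inner_diff_left inner_diff_right inner_commute)
      then show ?thesis using that by (simp add: h_def R_def)
    qed
    show "unitarily_implemented g" if "unitarily_implemented h"
      by (rule unitarily_implemented_reflection_comp[OF n(1) that])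
        (metis RR R_def comp_apply h_def)
  qed
qed

text \<open>Each reduction keeps the axes fixed before it, so three of them lead to the identity.\<close>
proposition orthogonal_unitarily_implemented:
  assumes g: "orthogonal_transformation (g :: real ^ 3 \<Rightarrow> real ^ 3)"
  shows "unitarily_implemented g"
proof -
  let ?e = "\<lambda>i. axis i (1 :: real) :: real ^ 3"
  obtain g1 where g1: "orthogonal_transformation g1" "g1 (?e 1) = ?e 1"
    "unitarily_implemented g1 \<Longrightarrow> unitarily_implemented g"
    by (rule unitarily_implemented_reduce[OF g, of "?e 1"]) (rule that)
  obtain g2 where g2: "orthogonal_transformation g2" "g2 (?e 2) = ?e 2"
    "\<And>x. g1 x = x \<Longrightarrow> x \<bullet> ?e 2 = 0 \<Longrightarrow> g2 x = x"
    "unitarily_implemented g2 \<Longrightarrow> unitarily_implemented g1"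
    using unitarily_implemented_reduce[OF g1(1), of "?e 2"] by blast
  obtain g3 where g3: "orthogonal_transformation g3" "g3 (?e 3) = ?e 3"
    "\<And>x. g2 x = x \<Longrightarrow> x \<bullet> ?e 3 = 0 \<Longrightarrow> g3 x = x"
    "unitarily_implemented g3 \<Longrightarrow> unitarily_implemented g2"
    using unitarily_implemented_reduce[OF g2(1), of "?e 3"] by blast
  have "g2 (?e 1) = ?e 1" using g1(2) by (intro g2(3)) (auto simp: inner_axis_axis)
  then have "g3 (?e i) = ?e i" for i
    using g2(2) g3(2,3) exhaust_3[of i] by (auto simp: inner_axis_axis)
  moreover have "linear g3" using g3(1) by (rule orthogonal_transformation_linear)
  moreover from calculation(1) have "g3 b = id b" if "b \<in> Basis" for b
    using that by (auto simp: Basis_vec_def)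
  ultimately have "g3 = id" using linear_eq_stdbasis[OF _ linear_id] by blast
  then have "g3 v = v" for v by simp
  then have "unitarily_implemented g3"
    unfolding unitarily_implemented_def using unitary_mat_1
    by (intro exI[of _ "mat 1"] exI[of _ 1]) (auto simp: unitary_def)
  then show ?thesis using g1 g2 g3 by blast
qed

text \<open>The half turn about the bisector of \<open>e\<close> and \<open>n\<close>, or about any orthogonal axis if \<open>n = - e\<close>, maps \<open>e\<close> to \<open>n\<close>.\<close>
lemma ex_half_turn:
  fixes e n :: "real ^ 3"
  assumes e: "norm e = 1" and n: "norm n = 1"
  obtains m where "norm m = 1" "(2 * (m \<bullet> e)) *\<^sub>R m - e = n"
proof (cases "n + e = 0")
  case True
  obtain m :: "real ^ 3" where m: "m \<noteq> 0" "orthogonal e m"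
    using orthogonal_to_vector_exists[of e] by auto
  show ?thesis
    by (rule that[of "sgn m"]) (use m True in \<open>auto simp: norm_sgn sgn_div_norm orthogonal_def inner_commute add_eq_0_iff\<close>)
next
  case False
  define m where "m = sgn (n + e)"
  have "(2 * (m \<bullet> e)) *\<^sub>R m = (2 * ((n + e) \<bullet> e) / (norm (n + e))\<^sup>2) *\<^sub>R (n + e)"
    by (simp add: m_def sgn_div_norm power2_eq_square divide_inverse)
  also have "2 * ((n + e) \<bullet> e) = (norm (n + e))\<^sup>2"
    using e n by (simp add: power2_norm_eq_inner inner_add_left inner_add_right norm_eq_1 inner_commute)
  finally have "(2 * (m \<bullet> e)) *\<^sub>R m = n + e" using False by simp
  then show ?thesis using that[of m] False by (simp add: m_def norm_sgn)
qed


lemma Diag2_herm: "Diag2 (of_real x) (of_real y) = herm ((x + y) / 2, ((x - y) / 2) *\<^sub>R axis 3 1)"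
  by (simp add: Diag2_def herm_def complex_eq_iff vec_eq_iff forall_2 axis_def field_simps)

section \<open>Continuous Jordan triple endomorphisms\<close>

theorem theorem1:
  fixes \<phi> :: "complex ^ 2 ^ 2 \<Rightarrow> complex ^ 2 ^ 2"
  assumes "jordan_triple_endomorphism P2 \<phi>"
    and "continuous_on P2 \<phi>"
  shows
    "(\<exists>U (c::real). unitary U \<and>
        (\<forall>A\<in>P2. \<phi> A = (Re (det A) powr c) *\<^sub>R (U ** A ** conj_transpose U)))
   \<or> (\<exists>V (d::real). unitary V \<and>
        (\<forall>A\<in>P2. \<phi> A = (Re (det A) powr d) *\<^sub>R (V ** matrix_inv A ** conj_transpose V)))
   \<or> (\<exists>W (c1::real) (c2::real). unitary W \<and>
        (\<forall>A\<in>P2. \<phi> A = W ** Diag2 (of_real (Re (det A) powr c1)) (of_real (Re (det A) powr c2))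
                        ** conj_transpose W))"
proof -
  define \<Phi> where "\<Phi> a = unherm (\<phi> (herm a))" for a
  have \<phi>_maps: "\<phi> (herm a) \<in> P2" if "a \<in> future_cone" for a
    using assms(1) that by (auto simp: jordan_triple_endomorphism_def herm_P2_iff)
  have herm_\<Phi>: "herm (\<Phi> a) = \<phi> (herm a)" if "a \<in> future_cone" for a
    using \<phi>_maps[OF that] by (simp add: \<Phi>_def herm_unherm)
  interpret cone_triple_hom \<Phi>
  proof
    show "\<Phi> a \<in> future_cone" if "a \<in> future_cone" for a
      using \<phi>_maps[OF that] by (simp add: herm_P2_iff[symmetric] herm_\<Phi>[OF that])
    show "\<Phi> (triple a b) = triple (\<Phi> a) (\<Phi> b)" if "a \<in> future_cone" "b \<in> future_cone" for a b
    proof -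
      have "herm (\<Phi> (triple a b)) = herm (triple (\<Phi> a) (\<Phi> b))"
        using assms(1) that
        by (simp add: herm_\<Phi> triple_fcone jordan_triple_endomorphism_def herm_P2_iff
            flip: herm_triple)
      then show ?thesis by (metis unherm_herm)
    qed
    show "continuous_on future_cone \<Phi>"
      unfolding \<Phi>_def
      by (intro continuous_on_compose2[OF continuous_on_unherm[of UNIV]]
          continuous_on_compose2[OF assms(2)] continuous_on_herm) (auto simp: herm_P2_iff)
  qed simp
  have P2_cases: "\<exists>a\<in>future_cone. A = herm a" if "A \<in> P2" for A
    using that herm_unherm[OF that] herm_P2_iff[of "unherm A"] by metis
  from hyp_triple_hom.rigidity[OF restricts_to_hyperboloid] show ?thesis
  proof
    assume "\<forall>a\<in>hyperboloid. \<Phi> a = one"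
    then obtain n c1 c2 where n: "norm n = 1" and \<Phi>: "\<And>a. a \<in> future_cone \<Longrightarrow>
        \<Phi> a = ((lorentz a powr c1 + lorentz a powr c2) / 2, ((lorentz a powr c1 - lorentz a powr c2) / 2) *\<^sub>R n)"
      using degenerate_form by blast
    obtain m where m: "norm m = 1" "(2 * (m \<bullet> axis 3 1)) *\<^sub>R m - axis 3 1 = n"
      using ex_half_turn[OF _ n, of "axis 3 1"] by auto
    let ?W = "herm (0, m)"
    have W: "?W ** herm (t, r *\<^sub>R axis 3 1) ** ?W = herm (t, r *\<^sub>R n)" for t r
      unfolding herm_half_turn[OF m(1)] by (simp flip: m(2) add: algebra_simps)
    have "\<phi> A = ?W ** Diag2 (of_real (Re (det A) powr c1)) (of_real (Re (det A) powr c2))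
        ** conj_transpose ?W" if A: "A \<in> P2" for A
    proof -
      obtain a where a: "a \<in> future_cone" "A = herm a" using P2_cases[OF A] by blast
      show ?thesis
        unfolding a(2) herm_\<Phi>[OF a(1), symmetric] \<Phi>[OF a(1)]
        by (simp add: det_herm Diag2_herm W)
    qed
    then show ?thesis
      by (intro disjI2 exI[of _ ?W] exI[of _ c1] exI[of _ c2] conjI ballI unitary_herm_unit[OF m(1)])
  next
    assume "\<forall>a\<in>hyperboloid. \<forall>b\<in>hyperboloid. \<Phi> a \<bullet> \<Phi> b = a \<bullet> b"
    then have iso: "\<Phi> a \<bullet> \<Phi> b = a \<bullet> b" if "a \<in> hyperboloid" "b \<in> hyperboloid" for a b
      using that by blast
    obtain c g where g: "orthogonal_transformation g"
      and \<Phi>: "\<And>a. a \<in> future_cone \<Longrightarrow> \<Phi> a = (lorentz a powr c) *\<^sub>R (fst a, g (snd a))"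
      by (rule isometric_form[OF iso]) (assumption | (rule that; assumption))+
    obtain U s where U: "unitary U" and s: "s = 1 \<or> s = - 1"
      and Ug: "\<And>t v. U ** herm (t, v) ** conj_transpose U = herm (t, s *\<^sub>R g v)"
      using orthogonal_unitarily_implemented[OF g] unfolding unitarily_implemented_def by blast
    have lin: "g (- v) = - g v" for v
      using g by (simp add: orthogonal_transformation_linear linear_neg)
    from s show ?thesis
    proof
      assume s: "s = 1"
      have "\<phi> A = (Re (det A) powr c) *\<^sub>R (U ** A ** conj_transpose U)" if A: "A \<in> P2" for A
      proof -
        obtain a where a: "a \<in> future_cone" "A = herm a" using P2_cases[OF A] by blast
        have "U ** A ** conj_transpose U = herm (fst a, g (snd a))"
          using Ug[of "fst a" "snd a"] s a by simp
        then show ?thesis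
          unfolding a(2) herm_\<Phi>[OF a(1), symmetric] \<Phi>[OF a(1)] herm_scaleR by (simp add: det_herm)
      qed
      then show ?thesis
        by (intro disjI1 exI[of _ U] exI[of _ c] conjI ballI U)
    next
      assume s: "s = - 1"
      have "\<phi> A = (Re (det A) powr (c + 1)) *\<^sub>R (U ** matrix_inv A ** conj_transpose U)"
        if A: "A \<in> P2" for A
      proof -
        obtain a where a: "a \<in> future_cone" "A = herm a" using P2_cases[OF A] by blast
        have l: "0 < lorentz a" using fconeD[OF a(1)] by simp
        have "U ** herm (bar a) ** conj_transpose U = herm (fst a, g (snd a))"
          using Ug[of "fst a" "- snd a"] s by (simp add: bar_def lin)
        then have "U ** matrix_inv A ** conj_transpose U = (1 / lorentz a) *\<^sub>R herm (fst a, g (snd a))"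
          using l by (simp add: a(2) matrix_inv_herm matrix_scalar_ac flip: scalar_matrix_assoc)
        then show ?thesis
          unfolding a(2) herm_\<Phi>[OF a(1), symmetric] \<Phi>[OF a(1)] herm_scaleR
          using l by (simp add: det_herm powr_add)
      qed
      then have "\<exists>V d. unitary V \<and> (\<forall>A\<in>P2. \<phi> A = (Re (det A) powr d) *\<^sub>R (V ** matrix_inv A ** conj_transpose V))"
        by (intro exI[of _ U] exI[of _ "c + 1"] conjI ballI U)
      then show ?thesis by (rule disjI1[THEN disjI2])
    qed
  qed
qed

end
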